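(* Let $\mathtt V=\{(V_n),(\tau^{\mathrm{op}})\}$ be a $\mathrm{FinSet}^{\mathrm{op}}$-representation, and let $(\Omega_n\subseteq V_n)_n$ satisfy $\tau^{\mathrm{op}}(f)\Omega_n\subseteq\Omega_m$ for all $f:[m]\to[n]$. Consider the map from $\varinjlim_{\mathcal D(\mathtt V)}\mathcal P(\Omega_n)^{\mathfrak S_n}$ to $\varprojlim_{\mathcal Z(\mathtt V)}\mathcal P(\Omega_m)^{\mathfrak S_m}$ sending $$\left(\mathrm{sym}_N^{\mathcal D(\mathtt V)}\mu_n\right)_{n\mid N}\ \mapsto\ \big(\mathrm{Law}(\tau^{\mathrm{op}}(F_{n,m})X)\big)_m,$$ where $X\sim\mu_n$ is independent of the uniformly random map $F_{n,m}:[m]\to[n]$. This map has a dense image in total variation; that is, for any $(\mu_m)\in\varprojlim_{\mathcal Z(\mathtt V)}\mathcal P(\Omega_m)^{\mathfrak S_m}$ there exist elements $(\mu_m^{(i)})_m$, $i=1,2,\dots$, of the image such that $\lim_{i\to\infty}\|\mu_m-\mu_m^{(i)}\|_{\mathrm{TV}}=0$ for each $m$. More precisely, for any $m\le n$ and any $\mu_n\in\mathcal P(V_n)^{\mathfrak S_n}$ we have $$\big\|\mathrm{Law}(\tau^{\mathrm{op}}(\iota_{n,m})X)-\mathrm{Law}(\tau^{\mathrm{op}}(F_{n,m})X)\big\|_{\mathrm{TV}}\le\frac{m(m-1)}{n},$$ where $X\sim\mu_n$ is independent of $F_{n,m}$.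
   Context: Dimension indices $n,m,N,M$ are positive integers; $[n]=\{1,\dots,n\}$; $n\mid N$ is divisibility; $\mathfrak S_n$ is the symmetric group on $[n]$. A $\mathrm{FinSet}^{\mathrm{op}}$-representation $\mathtt V=\{(V_n),(\tau^{\mathrm{op}})\}$ is a sequence of finite-dimensional real vector spaces $V_n$ together with a linear map $\tau^{\mathrm{op}}(f):V_m\to V_n$ for each map $f:[n]\to[m]$, such that $\tau^{\mathrm{op}}(\mathrm{id}_{[n]})=\mathrm{id}_{V_n}$ and $\tau^{\mathrm{op}}(f_1\circ f_2)=\tau^{\mathrm{op}}(f_2)\circ\tau^{\mathrm{op}}(f_1)$ whenever the composition is defined. $\mathfrak S_n$ acts on $V_n$ by $\sigma\cdot x=\tau^{\mathrm{op}}(\sigma^{-1})x$; each $V_n$ carries an $\mathfrak S_n$-invariant inner product, and $^\star$ is the adjoint. For $n\le N$, $\iota_{N,n}:[n]\hookrightarrow[N]$ is the inclusion; for $N=nk$, $d_{n,N}:[N]\to[n]$ is the standard equipartition $d_{n,nk}(k(i-1)+j)=i$ for $i\in[n]$, $j\in[k]$. $\mathcal Z(\mathtt V)$ is the sequence $(V_n)$ with embeddings $\tau^{\mathrm{op}}(\iota_{N,n})^\star:V_n\to V_N$ for $n\le N$ (so the adjoint projections are $\tau^{\mathrm{op}}(\iota_{N,n}):V_N\to V_n$), and $\mathcal D(\mathtt V)$ is the sequence $(V_n)$ with embeddings $\tau^{\mathrm{op}}(d_{n,N}):V_n\to V_N$ for $n\mid N$. $\mathcal P(\Omega)$ is the set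 of Borel probability measures on $\Omega$ and $\mathcal P(\Omega)^{\mathfrak S_n}$ the $\mathfrak S_n$-invariant ones. $\varprojlim_{\mathcal Z(\mathtt V)}\mathcal P(\Omega_m)^{\mathfrak S_m}$ is the set of sequences $(\mu_m)_m$, $\mu_m\in\mathcal P(\Omega_m)^{\mathfrak S_m}$, such that the pushforward of $\mu_M$ under $\tau^{\mathrm{op}}(\iota_{M,m})$ is $\mu_m$ for all $m\le M$. For $n\mid N$, $\mathrm{sym}_N^{\mathcal D(\mathtt V)}\mu_n=\mathrm{Law}(\Pi_N\cdot\tau^{\mathrm{op}}(d_{n,N})X)$ with $X\sim\mu_n$ and $\Pi_N\in\mathfrak S_N$ independent and uniformly random. $\varinjlim_{\mathcal D(\mathtt V)}\mathcal P(\Omega_n)^{\mathfrak S_n}$ is $\bigsqcup_n\mathcal P(\Omega_n)^{\mathfrak S_n}$ modulo the equivalence relation generated by $\mu_n\sim\mathrm{sym}_N^{\mathcal D(\mathtt V)}\mu_n$ for $n\mid N$; the class of $\mu_n$ is written $(\mathrm{sym}_N^{\mathcal D(\mathtt V)}\mu_n)_{n\mid N}$. Total variation is normalized as $\|\mu-\nu\|_{\mathrm{TV}}=\sup_{h:\Omega\to[-1,1]}|\mathbb E_\mu h-\mathbb E_\nu h|$ ($h$ measurable), i.e. $\sum_x|\mu(x)-\nu(x)|$ on a finite set. *)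

theory Defs
  imports "HOL-Probability.Probability"
begin

section \<open>Representations of the opposite category of finite sets\<close>

text \<open>
  Maps between the sets \<open>[m] = {1..m}\<close> (\<open>m \<ge> 1\<close>) are represented extensionally, as elements of
  \<open>{1..m} \<rightarrow>\<^sub>E {1..n}\<close>. Such a function does not determine its codomain, so the
  structure map of \<open>f : [m] \<rightarrow> [n]\<close> is written \<open>\<tau> m n f : V n \<rightarrow> V m\<close>, with both indices.
\<close>

abbreviation fin_maps :: "nat \<Rightarrow> nat \<Rightarrow> (nat \<Rightarrow> nat) set" where
  "fin_maps m n \<equiv> {1..m} \<rightarrow>\<^sub>E {1..n}"

definition incl :: "nat \<Rightarrow> nat \<Rightarrow> nat" where
  "incl n = (\<lambda>i\<in>{1..n}. i)"

definition perm_map :: "nat \<Rightarrow> (nat \<Rightarrow> nat) \<Rightarrow> nat \<Rightarrow> nat" where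
  "perm_map n \<sigma> = restrict \<sigma> {1..n}"

definition perm_act ::
    "(nat \<Rightarrow> nat \<Rightarrow> (nat \<Rightarrow> nat) \<Rightarrow> 'v \<Rightarrow> 'v) \<Rightarrow> nat \<Rightarrow> (nat \<Rightarrow> nat) \<Rightarrow> 'v \<Rightarrow> 'v" where
  "perm_act \<tau> n \<sigma> x = \<tau> n n (perm_map n (inv \<sigma>)) x"

definition equipart :: "nat \<Rightarrow> nat \<Rightarrow> nat \<Rightarrow> nat" where
  "equipart n N = (\<lambda>l\<in>{1..N}. (l - 1) div (N div n) + 1)"

lemma equipart_block:
  assumes "i \<in> {1..n}" "j \<in> {1..k}"
  shows "equipart n (n * k) (k * (i - 1) + j) = i"
proof -
  obtain i' where i: "i = Suc i'" "i' < n" using assms(1) by (cases i) auto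
  obtain j' where j: "j = Suc j'" "j' < k" using assms(2) by (cases j) auto
  have "k * i' + j \<le> k * i' + k" using j by simp
  also have "\<dots> = k * Suc i'" by simp
  also have "\<dots> \<le> k * n" using i by (intro mult_le_mono2) simp
  finally have "k * i' + j \<in> {1..n * k}" using j by (simp add: mult.commute)
  then show ?thesis using i j by (simp add: equipart_def)
qed

text \<open>
  The spaces \<open>V n\<close> are finite-dimensional subspaces of one ambient normed space (any sequence of
  finite-dimensional spaces can be placed in, e.g., the space of finitely supported sequences);
  the ambient space only serves to give the \<open>V n\<close> a common type and their Borel structure, and
  the structure maps are constrained on the \<open>V n\<close> only. The inner product \<open>ip n\<close> on \<open>V n\<close> is
  unrelated to the ambient norm and may vary freely with \<open>n\<close>. The embeddings of the sequence
  \<open>\<Z>(V)\<close> are the adjoints of \<open>\<tau> n N (incl n)\<close> with respect to \<open>ip\<close>; inverse limits over it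
  involve only the adjoints of these embeddings, i.e. the maps \<open>\<tau> n N (incl n)\<close> themselves.
\<close>

locale finset_op_rep =
  fixes V :: "nat \<Rightarrow> 'v::real_normed_vector set"
    and \<tau> :: "nat \<Rightarrow> nat \<Rightarrow> (nat \<Rightarrow> nat) \<Rightarrow> 'v \<Rightarrow> 'v"
    and ip :: "nat \<Rightarrow> 'v \<Rightarrow> 'v \<Rightarrow> real"
  assumes V_subspace: "n \<ge> 1 \<Longrightarrow> subspace (V n)"
    and V_finite_dim: "n \<ge> 1 \<Longrightarrow> \<exists>B. finite B \<and> span B = V n"
    and \<tau>_maps: "\<lbrakk>m \<ge> 1; n \<ge> 1; f \<in> fin_maps m n; x \<in> V n\<rbrakk> \<Longrightarrow> \<tau> m n f x \<in> V m"
    and \<tau>_add: "\<lbrakk>m \<ge> 1; n \<ge> 1; f \<in> fin_maps m n; x \<in> V n; y \<in> V n\<rbrakk>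
        \<Longrightarrow> \<tau> m n f (x + y) = \<tau> m n f x + \<tau> m n f y"
    and \<tau>_scale: "\<lbrakk>m \<ge> 1; n \<ge> 1; f \<in> fin_maps m n; x \<in> V n\<rbrakk>
        \<Longrightarrow> \<tau> m n f (c *\<^sub>R x) = c *\<^sub>R \<tau> m n f x"
    and \<tau>_id: "\<lbrakk>n \<ge> 1; x \<in> V n\<rbrakk> \<Longrightarrow> \<tau> n n (incl n) x = x"
    and \<tau>_comp: "\<lbrakk>l \<ge> 1; m \<ge> 1; n \<ge> 1; f \<in> fin_maps m n; g \<in> fin_maps l m; x \<in> V n\<rbrakk>
        \<Longrightarrow> \<tau> l n (compose {1..l} f g) x = \<tau> l m g (\<tau> m n f x)"
    and ip_sym: "\<lbrakk>n \<ge> 1; x \<in> V n; y \<in> V n\<rbrakk> \<Longrightarrow> ip n x y = ip n y x"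
    and ip_add: "\<lbrakk>n \<ge> 1; x \<in> V n; y \<in> V n; z \<in> V n\<rbrakk> \<Longrightarrow> ip n (x + y) z = ip n x z + ip n y z"
    and ip_scale: "\<lbrakk>n \<ge> 1; x \<in> V n; y \<in> V n\<rbrakk> \<Longrightarrow> ip n (c *\<^sub>R x) y = c * ip n x y"
    and ip_pos: "\<lbrakk>n \<ge> 1; x \<in> V n; x \<noteq> 0\<rbrakk> \<Longrightarrow> ip n x x > 0"
    and ip_invariant: "\<lbrakk>n \<ge> 1; \<sigma> permutes {1..n}; x \<in> V n; y \<in> V n\<rbrakk>
        \<Longrightarrow> ip n (perm_act \<tau> n \<sigma> x) (perm_act \<tau> n \<sigma> y) = ip n x y"


section \<open>Invariant measures and their limits\<close>

abbreviation borel_on :: "'v::topological_space set \<Rightarrow> 'v measure" where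
  "borel_on S \<equiv> restrict_space borel S"

definition borel_probs :: "'v::topological_space set \<Rightarrow> 'v measure set" where
  "borel_probs S = {\<mu>. prob_space \<mu> \<and> sets \<mu> = sets (borel_on S)}"

definition inv_probs ::
    "(nat \<Rightarrow> nat \<Rightarrow> (nat \<Rightarrow> nat) \<Rightarrow> 'v \<Rightarrow> 'v) \<Rightarrow> (nat \<Rightarrow> 'v::topological_space set) \<Rightarrow> nat
      \<Rightarrow> 'v measure set" where
  "inv_probs \<tau> \<Omega> n = {\<mu> \<in> borel_probs (\<Omega> n).
      \<forall>\<sigma>. \<sigma> permutes {1..n} \<longrightarrow> distr \<mu> (borel_on (\<Omega> n)) (perm_act \<tau> n \<sigma>) = \<mu>}"

text \<open>The law of \<open>\<tau>(\<iota>) X\<close> for \<open>X \<sim> \<mu>\<close> on \<open>\<Omega> n\<close> and the inclusion \<open>\<iota> : [m] \<rightarrow> [n]\<close>, \<open>m \<le> n\<close>.\<close>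

definition law_incl ::
    "(nat \<Rightarrow> nat \<Rightarrow> (nat \<Rightarrow> nat) \<Rightarrow> 'v \<Rightarrow> 'v) \<Rightarrow> (nat \<Rightarrow> 'v::topological_space set) \<Rightarrow> nat \<Rightarrow> nat
      \<Rightarrow> 'v measure \<Rightarrow> 'v measure" where
  "law_incl \<tau> \<Omega> m n \<mu> = distr \<mu> (borel_on (\<Omega> m)) (\<tau> m n (incl m))"

text \<open>The law of \<open>\<tau>(F) X\<close> for independent \<open>X \<sim> \<mu>\<close> and \<open>F : [m] \<rightarrow> [n]\<close> uniformly random.\<close>

definition law_random_map ::
    "(nat \<Rightarrow> nat \<Rightarrow> (nat \<Rightarrow> nat) \<Rightarrow> 'v \<Rightarrow> 'v) \<Rightarrow> (nat \<Rightarrow> 'v::topological_space set) \<Rightarrow> nat \<Rightarrow> nat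
      \<Rightarrow> 'v measure \<Rightarrow> 'v measure" where
  "law_random_map \<tau> \<Omega> m n \<mu> =
     distr (\<mu> \<Otimes>\<^sub>M uniform_count_measure (fin_maps m n)) (borel_on (\<Omega> m)) (\<lambda>(x, f). \<tau> m n f x)"

definition sym_embed ::
    "(nat \<Rightarrow> nat \<Rightarrow> (nat \<Rightarrow> nat) \<Rightarrow> 'v \<Rightarrow> 'v) \<Rightarrow> (nat \<Rightarrow> 'v::topological_space set) \<Rightarrow> nat \<Rightarrow> nat
      \<Rightarrow> 'v measure \<Rightarrow> 'v measure" where
  "sym_embed \<tau> \<Omega> n N \<mu> =
     distr (\<mu> \<Otimes>\<^sub>M uniform_count_measure {\<sigma>. \<sigma> permutes {1..N}}) (borel_on (\<Omega> N))
       (\<lambda>(x, \<sigma>). perm_act \<tau> N \<sigma> (\<tau> N n (equipart n N) x))"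

text \<open>Sequences indexed by the positive integers are functions that are \<open>undefined\<close> at \<open>0\<close>.\<close>

definition inv_limit ::
    "(nat \<Rightarrow> nat \<Rightarrow> (nat \<Rightarrow> nat) \<Rightarrow> 'v \<Rightarrow> 'v) \<Rightarrow> (nat \<Rightarrow> 'v::topological_space set)
      \<Rightarrow> (nat \<Rightarrow> 'v measure) set" where
  "inv_limit \<tau> \<Omega> = {\<mu> \<in> \<Pi>\<^sub>E m\<in>{1..}. inv_probs \<tau> \<Omega> m.
      \<forall>m M. 1 \<le> m \<longrightarrow> m \<le> M \<longrightarrow> law_incl \<tau> \<Omega> m M (\<mu> M) = \<mu> m}"

text \<open>The disjoint union is the set of pairs of an index and a measure.\<close>

definition dir_union ::
    "(nat \<Rightarrow> nat \<Rightarrow> (nat \<Rightarrow> nat) \<Rightarrow> 'v \<Rightarrow> 'v) \<Rightarrow> (nat \<Rightarrow> 'v::topological_space set)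
      \<Rightarrow> (nat \<times> 'v measure) set" where
  "dir_union \<tau> \<Omega> = (SIGMA n:{1..}. inv_probs \<tau> \<Omega> n)"

inductive dir_step ::
    "(nat \<Rightarrow> nat \<Rightarrow> (nat \<Rightarrow> nat) \<Rightarrow> 'v \<Rightarrow> 'v) \<Rightarrow> (nat \<Rightarrow> 'v::topological_space set)
      \<Rightarrow> nat \<times> 'v measure \<Rightarrow> nat \<times> 'v measure \<Rightarrow> bool"
  for \<tau> \<Omega> where
  "\<lbrakk>n \<ge> 1; N \<ge> 1; n dvd N; \<mu> \<in> inv_probs \<tau> \<Omega> n\<rbrakk>
    \<Longrightarrow> dir_step \<tau> \<Omega> (n, \<mu>) (N, sym_embed \<tau> \<Omega> n N \<mu>)"

definition dir_rel ::
    "(nat \<Rightarrow> nat \<Rightarrow> (nat \<Rightarrow> nat) \<Rightarrow> 'v \<Rightarrow> 'v) \<Rightarrow> (nat \<Rightarrow> 'v::topological_space set)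
      \<Rightarrow> ((nat \<times> 'v measure) \<times> (nat \<times> 'v measure)) set" where
  "dir_rel \<tau> \<Omega> = {(p, q). p \<in> dir_union \<tau> \<Omega> \<and> q \<in> dir_union \<tau> \<Omega> \<and> equivclp (dir_step \<tau> \<Omega>) p q}"

definition dir_limit ::
    "(nat \<Rightarrow> nat \<Rightarrow> (nat \<Rightarrow> nat) \<Rightarrow> 'v \<Rightarrow> 'v) \<Rightarrow> (nat \<Rightarrow> 'v::topological_space set)
      \<Rightarrow> (nat \<times> 'v measure) set set" where
  "dir_limit \<tau> \<Omega> = dir_union \<tau> \<Omega> // dir_rel \<tau> \<Omega>"

definition law_seq ::
    "(nat \<Rightarrow> nat \<Rightarrow> (nat \<Rightarrow> nat) \<Rightarrow> 'v \<Rightarrow> 'v) \<Rightarrow> (nat \<Rightarrow> 'v::topological_space set)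
      \<Rightarrow> nat \<times> 'v measure \<Rightarrow> nat \<Rightarrow> 'v measure" where
  "law_seq \<tau> \<Omega> p = (\<lambda>m\<in>{1..}. law_random_map \<tau> \<Omega> m (fst p) (snd p))"

text \<open>
  The map on classes induced by \<open>law_seq\<close>; \<open>the_elem\<close> is meaningful once \<open>law_seq\<close> is known to
  be constant on classes.
\<close>

definition limit_map ::
    "(nat \<Rightarrow> nat \<Rightarrow> (nat \<Rightarrow> nat) \<Rightarrow> 'v \<Rightarrow> 'v) \<Rightarrow> (nat \<Rightarrow> 'v::topological_space set)
      \<Rightarrow> (nat \<times> 'v measure) set \<Rightarrow> nat \<Rightarrow> 'v measure" where
  "limit_map \<tau> \<Omega> c = the_elem (law_seq \<tau> \<Omega> ` c)"


section \<open>Total variation\<close>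

text \<open>
  Normalized to take values in \<open>[0, 2]\<close> on pairs of probability measures; only meaningful for
  finite measures on the same measurable space.
\<close>

definition tv_dist :: "'a measure \<Rightarrow> 'a measure \<Rightarrow> real" where
  "tv_dist \<mu> \<nu> = (SUP h \<in> {h \<in> borel_measurable \<mu>. \<forall>x\<in>space \<mu>. h x \<in> {-1..1}}.
      \<bar>(\<integral>x. h x \<partial>\<mu>) - (\<integral>x. h x \<partial>\<nu>)\<bar>)"

end

theory Submission
  imports Defs
begin

text \<open>
  All the maps involved amount to averaging the laws of \<open>\<tau>(f) X\<close> over a uniformly random \<open>f\<close>.
  If \<open>\<phi> : S \<rightarrow> T\<close> has fibres of equal size, then averaging over \<open>s \<in> S\<close> a quantity that depends on
  \<open>\<phi> s\<close> only is the same as averaging over \<open>T\<close>. Precomposition with an injection and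
  postcomposition with a permuted equipartition have fibres of equal size; the former gives
  the invariance and the consistency of the laws of \<open>\<tau>(F\<^sub>n\<^sub>,\<^sub>m) X\<close>, the latter their independence
  of the representative in the direct limit.

  For the total variation bound, an injective \<open>f : [m] \<rightarrow> [n]\<close> extends to a permutation of \<open>[n]\<close>, so
  that by invariance \<open>\<tau>(f) X\<close> has the law of \<open>\<tau>(\<iota>) X\<close>. The two laws therefore differ by at most twice the
  probability that \<open>F\<^sub>n\<^sub>,\<^sub>m\<close> is not injective, which is at most \<open>m(m-1)/(2n)\<close>. Density follows
  by approximating \<open>(\<mu>\<^sub>m)\<close> with the images of the classes of \<open>\<mu>\<^sub>n\<close> as \<open>n \<rightarrow> \<infinity>\<close>.
\<close>

section \<open>Linear maps on finite-dimensional subspaces\<close>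

text \<open>The bound turns a convergent sequence in the span into Cauchy coefficient sequences, so
  the limit can be taken coefficient by coefficient. It is a hypothesis so that the lemma can serve
  within the induction that proves such a bound.\<close>

lemma closed_span_of_coordinate_bound:
  fixes B :: "'v::real_normed_vector set"
  assumes fin: "finite B"
    and bound: "\<And>c. (\<Sum>b\<in>B. \<bar>c b\<bar>) \<le> C * norm (\<Sum>b\<in>B. c b *\<^sub>R b)"
    and C: "C \<ge> 0"
  shows "closed (span B)"
  unfolding closed_sequential_limits
proof (intro allI impI, elim conjE)
  fix X l assume X: "\<forall>n. X n \<in> span B" and lim: "X \<longlonglongrightarrow> l"
  have "\<forall>n. \<exists>c. X n = (\<Sum>b\<in>B. c b *\<^sub>R b)"
    using X unfolding span_finite[OF fin] by auto
  then obtain c where c: "\<And>n. X n = (\<Sum>b\<in>B. c n b *\<^sub>R b)" by metis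
  have "Cauchy (\<lambda>n. c n b)" if b: "b \<in> B" for b
  proof (rule CauchyI)
    fix e :: real assume e: "e > 0"
    have "Cauchy X" using lim by (rule LIMSEQ_imp_Cauchy)
    \<comment> \<open>Dividing by \<open>C + 1\<close> covers the case \<open>C = 0\<close>.\<close>
    moreover have "e / (C + 1) > 0" using e C by simp
    ultimately obtain M where M: "\<And>j k. j \<ge> M \<Longrightarrow> k \<ge> M \<Longrightarrow> norm (X j - X k) < e / (C + 1)"
      by (meson CauchyD)
    have "norm (c j b - c k b) < e" if "j \<ge> M" "k \<ge> M" for j k
    proof -
      have "\<bar>c j b - c k b\<bar> \<le> (\<Sum>b\<in>B. \<bar>c j b - c k b\<bar>)"
        by (rule member_le_sum[OF b]) (use fin in auto)
      also have "\<dots> \<le> C * norm (X j - X k)"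
        using bound[of "\<lambda>b. c j b - c k b"] by (simp add: c scaleR_diff_left sum_subtractf)
      also have "\<dots> \<le> (C + 1) * norm (X j - X k)" by (simp add: mult_right_mono)
      also have "\<dots> < e"
        using M[OF that] C by (simp add: field_simps)
      finally show ?thesis by simp
    qed
    then show "\<exists>M. \<forall>j\<ge>M. \<forall>k\<ge>M. norm (c j b - c k b) < e" by blast
  qed
  then have "\<forall>b\<in>B. \<exists>L. (\<lambda>n. c n b) \<longlonglongrightarrow> L"
    by (meson Cauchy_convergent convergent_def)
  then obtain L where L: "\<And>b. b \<in> B \<Longrightarrow> (\<lambda>n. c n b) \<longlonglongrightarrow> L b" by metis
  have "X \<longlonglongrightarrow> (\<Sum>b\<in>B. L b *\<^sub>R b)"
    unfolding c[abs_def] by (intro tendsto_intros L)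
  then have "l = (\<Sum>b\<in>B. L b *\<^sub>R b)" using lim LIMSEQ_unique by blast
  then show "l \<in> span B" by (simp add: span_base span_scale span_sum)
qed

text \<open>In a finite-dimensional subspace of any normed space the l1 norm of the coordinates is
  dominated by the ambient norm. In the induction, \<open>span B\<close> is closed by the induction
  hypothesis, so the new vector \<open>a\<close> has positive distance from it. This distance
  controls the coefficient of \<open>a\<close>, and then the remaining ones.\<close>

lemma coordinates_bounded:
  fixes B :: "'v::real_normed_vector set"
  assumes "finite B" "independent B"
  shows "\<exists>C\<ge>0. \<forall>c. (\<Sum>b\<in>B. \<bar>c b\<bar>) \<le> C * norm (\<Sum>b\<in>B. c b *\<^sub>R b)"
  using assms
proof (induction B rule: finite_induct)
  case empty
  show ?case by (intro exI[of _ 0]) simp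
next
  case (insert a B)
  have a: "a \<notin> span B" and ind: "independent B"
    using insert by (auto simp: independent_insert)
  obtain C where C: "C \<ge> 0" "\<And>c. (\<Sum>b\<in>B. \<bar>c b\<bar>) \<le> C * norm (\<Sum>b\<in>B. c b *\<^sub>R b)"
    using insert.IH[OF ind] by blast
  have "open (- span B)"
    using closed_span_of_coordinate_bound[OF insert.hyps(1) C(2,1)] by (simp add: closed_def)
  then obtain d where d: "d > 0" "ball a d \<subseteq> - span B"
    using a open_contains_ball by blast
  have far: "d \<le> norm (a + s)" if "s \<in> span B" for s
  proof (rule ccontr)
    assume "\<not> d \<le> norm (a + s)"
    then have "- s \<in> ball a d" by (simp add: dist_norm)
    moreover have "- s \<in> span B" using that by (rule span_neg)
    ultimately show False using d by blast
  qed
  show ?case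
  proof (intro exI conjI allI)
    \<comment> \<open>The first summand pays for the coefficient of \<open>a\<close>, at most
      \<open>norm t / d\<close>. The second pays for those on \<open>B\<close>, at most
      \<open>C * norm s\<close>, where \<open>norm s\<close> is at most
      \<open>norm t * (1 + norm a / d)\<close>.\<close>
    define K where "K = 1 / d + C * (1 + norm a / d)"
    show "K \<ge> 0" using C d by (simp add: K_def)
    fix c
    define s where "s = (\<Sum>b\<in>B. c b *\<^sub>R b)"
    define t where "t = c a *\<^sub>R a + s"
    have s: "s \<in> span B" unfolding s_def by (simp add: span_base span_scale span_sum)
    have "\<bar>c a\<bar> * d \<le> norm t"
    proof (cases "c a = 0")
      case False
      have "t = c a *\<^sub>R (a + (1 / c a) *\<^sub>R s)"
        using False by (simp add: t_def algebra_simps)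
      then have "norm t = \<bar>c a\<bar> * norm (a + (1 / c a) *\<^sub>R s)" by simp
      then show ?thesis using far[of "(1 / c a) *\<^sub>R s"] s by (simp add: span_scale mult_left_mono)
    qed simp
    then have ca: "\<bar>c a\<bar> \<le> norm t / d" using d by (simp add: field_simps)
    have "norm s = norm (t - c a *\<^sub>R a)" by (simp add: t_def)
    also have "\<dots> \<le> norm t + \<bar>c a\<bar> * norm a" using norm_triangle_ineq4[of t "c a *\<^sub>R a"] by simp
    also have "\<dots> \<le> norm t + norm t / d * norm a" using mult_right_mono[OF ca norm_ge_zero[of a]] by simp
    finally have ns: "norm s \<le> norm t * (1 + norm a / d)" by (simp add: algebra_simps)
    have "(\<Sum>b\<in>insert a B. \<bar>c b\<bar>) = \<bar>c a\<bar> + (\<Sum>b\<in>B. \<bar>c b\<bar>)"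
      using insert by simp
    also have "\<dots> \<le> norm t / d + C * norm s" using ca C(2)[of c] by (simp add: s_def)
    also have "\<dots> \<le> norm t / d + C * (norm t * (1 + norm a / d))"
      using ns C(1) by (simp add: mult_left_mono)
    also have "\<dots> = K * norm t" by (simp add: K_def algebra_simps)
    also have "t = (\<Sum>b\<in>insert a B. c b *\<^sub>R b)" using insert by (simp add: t_def s_def)
    finally show "(\<Sum>b\<in>insert a B. \<bar>c b\<bar>) \<le> K * norm (\<Sum>b\<in>insert a B. c b *\<^sub>R b)" .
  qed
qed

text \<open>Linearity is assumed on the span only, matching the structure maps, which are
  constrained only on the spaces \<open>V n\<close>. Bounded coordinates make \<open>f\<close>
  Lipschitz there.\<close>

lemma linear_on_finite_span_continuous:
  fixes f :: "'v::real_normed_vector \<Rightarrow> 'w::real_normed_vector"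
  assumes fin: "finite B"
    and add: "\<And>x y. x \<in> span B \<Longrightarrow> y \<in> span B \<Longrightarrow> f (x + y) = f x + f y"
    and scale: "\<And>r x. x \<in> span B \<Longrightarrow> f (r *\<^sub>R x) = r *\<^sub>R f x"
  shows "continuous_on (span B) f"
proof -
  \<comment> \<open>The spanning set may be dependent; an independent subset with the same span
    makes the coordinate bound available.\<close>
  obtain B' where B': "B' \<subseteq> span B" "independent B'" "span B \<subseteq> span B'" "B' \<subseteq> B"
    by (metis maximal_independent_subset span_base span_minimal subspace_span subset_iff)
  have fin': "finite B'" using B' fin finite_subset by blast
  have eq: "span B' = span B" using B' by (simp add: span_mono subset_antisym)
  obtain C where C: "C \<ge> 0" "\<And>c. (\<Sum>b\<in>B'. \<bar>c b\<bar>) \<le> C * norm (\<Sum>b\<in>B'. c b *\<^sub>R b)"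
    using coordinates_bounded[OF fin' B'(2)] by blast
  have f0: "f 0 = 0" using scale[of 0 0] by (simp add: span_zero)
  have f_sum: "f (\<Sum>b\<in>A. c b *\<^sub>R b) = (\<Sum>b\<in>A. c b *\<^sub>R f b)" if "A \<subseteq> B'" for A c
    using finite_subset[OF that fin'] that
  proof (induction A rule: finite_induct)
    case (insert a A)
    have "a \<in> span B" "(\<Sum>b\<in>A. c b *\<^sub>R b) \<in> span B"
      using insert.prems B'(1) by (auto intro!: span_sum span_scale)
    then show ?case using insert by (simp add: add scale span_scale)
  qed (simp add: f0)
  define K where "K = C * (\<Sum>b\<in>B'. norm (f b))"
  have K: "K \<ge> 0" using C by (simp add: K_def sum_nonneg)
  have bound: "norm (f x) \<le> K * norm x" if "x \<in> span B" for x
  proof -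
    have "\<exists>c. x = (\<Sum>b\<in>B'. c b *\<^sub>R b)"
      using that unfolding eq[symmetric] span_finite[OF fin'] by auto
    then obtain c where c: "x = (\<Sum>b\<in>B'. c b *\<^sub>R b)" ..
    have "norm (f x) \<le> (\<Sum>b\<in>B'. \<bar>c b\<bar> * norm (f b))"
      unfolding c f_sum[OF order_refl] by (rule sum_norm_le) simp
    also have "\<dots> \<le> (\<Sum>b\<in>B'. (\<Sum>b\<in>B'. \<bar>c b\<bar>) * norm (f b))"
      by (intro sum_mono mult_right_mono member_le_sum) (use fin' in auto)
    also have "\<dots> \<le> (\<Sum>b\<in>B'. C * norm x * norm (f b))"
      using C(2)[of c] by (intro sum_mono mult_right_mono) (auto simp: c)
    also have "\<dots> = K * norm x" by (simp add: K_def sum_distrib_left sum_distrib_right mult_ac)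
    finally show ?thesis .
  qed
  have "K-lipschitz_on (span B) f"
  proof (rule lipschitz_onI)
    fix x y assume xy: "x \<in> span B" "y \<in> span B"
    have "f (x - y) = f x - f y"
      using add[of x "(-1) *\<^sub>R y"] scale[of y "-1"] xy by (simp add: span_neg)
    then show "dist (f x) (f y) \<le> K * dist x y"
      using bound[of "x - y"] xy by (simp add: dist_norm span_diff)
  qed (rule K)
  then show ?thesis by (rule lipschitz_on_continuous_on)
qed

section \<open>Mixtures over a uniformly random index\<close>

text \<open>With a finite, discrete second factor, joint measurability reduces to that of each
  section.\<close>

lemma measurable_pair_uniform_count:
  assumes "finite S" "\<And>s. s \<in> S \<Longrightarrow> g s \<in> measurable M N"
  shows "(\<lambda>(x, s). g s x) \<in> measurable (M \<Otimes>\<^sub>M uniform_count_measure S) N"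
proof -
  have "(\<lambda>(x, s). g s x) \<in> measurable (M \<Otimes>\<^sub>M count_space S) N"
    unfolding split_beta
    by (rule measurable_compose_countable'[where f = "\<lambda>s z. g s (fst z)" and g = snd and I = S])
       (use assms in \<open>auto intro: countable_finite measurable_compose[OF measurable_fst]\<close>)
  then show ?thesis
    by (subst measurable_cong_sets[OF sets_pair_measure_cong[OF refl sets_uniform_count_measure_count_space] refl])
qed

lemma prob_space_distr_pair_uniform_count:
  assumes "prob_space M" "finite S" "S \<noteq> {}" "\<And>s. s \<in> S \<Longrightarrow> g s \<in> measurable M N"
  shows "prob_space (distr (M \<Otimes>\<^sub>M uniform_count_measure S) N (\<lambda>(x, s). g s x))"
proof -
  interpret M: prob_space M by fact
  interpret U: prob_space "uniform_count_measure S"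
    using assms by (simp add: prob_space_uniform_count_measure)
  interpret pair_prob_space M "uniform_count_measure S" ..
  show ?thesis by (intro prob_space_distr measurable_pair_uniform_count assms)
qed

text \<open>Fubini, with the bound on \<open>h\<close> supplying integrability: a mixture over a
  uniform index integrates to the average of the integrals.\<close>

lemma integral_distr_pair_uniform_count:
  fixes h :: "'b \<Rightarrow> real"
  assumes M: "prob_space M" and S: "finite S" "S \<noteq> {}"
    and g: "\<And>s. s \<in> S \<Longrightarrow> g s \<in> measurable M N"
    and h: "h \<in> borel_measurable N" "\<And>y. y \<in> space N \<Longrightarrow> \<bar>h y\<bar> \<le> c"
  shows "(\<integral>y. h y \<partial>distr (M \<Otimes>\<^sub>M uniform_count_measure S) N (\<lambda>(x, s). g s x))
    = (\<Sum>s\<in>S. \<integral>y. h y \<partial>distr M N (g s)) / real (card S)"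
proof -
  interpret M: prob_space M by fact
  interpret U: prob_space "uniform_count_measure S"
    using S by (simp add: prob_space_uniform_count_measure)
  interpret P: pair_prob_space M "uniform_count_measure S" ..
  note meas = measurable_pair_uniform_count[of S g M N, OF S(1) g]
  have eq: "(\<lambda>z. h (case z of (x, s) \<Rightarrow> g s x)) = (\<lambda>(x, s). h (g s x))" by auto
  have int: "integrable (M \<Otimes>\<^sub>M uniform_count_measure S) (\<lambda>(x, s). h (g s x))"
  proof (rule P.integrable_const_bound[where B = c])
    show "(\<lambda>(x, s). h (g s x)) \<in> borel_measurable (M \<Otimes>\<^sub>M uniform_count_measure S)"
      using measurable_compose[OF meas h(1)] by (simp add: eq)
    show "AE z in M \<Otimes>\<^sub>M uniform_count_measure S. norm (case z of (x, s) \<Rightarrow> h (g s x)) \<le> c"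
      using measurable_space[OF meas] h(2) by (intro AE_I2) fastforce
  qed
  have "(\<integral>y. h y \<partial>distr (M \<Otimes>\<^sub>M uniform_count_measure S) N (\<lambda>(x, s). g s x))
      = (\<integral>z. (case z of (x, s) \<Rightarrow> h (g s x)) \<partial>(M \<Otimes>\<^sub>M uniform_count_measure S))"
    by (simp add: integral_distr[OF meas h(1)] eq)
  also have "\<dots> = (\<integral>s. (\<integral>x. h (g s x) \<partial>M) \<partial>uniform_count_measure S)"
    using P.integral_snd[OF int] by simp
  also have "\<dots> = (\<Sum>s\<in>S. \<integral>x. h (g s x) \<partial>M) / real (card S)"
    using S by (simp add: integral_uniform_count_measure)
  also have "(\<Sum>s\<in>S. \<integral>x. h (g s x) \<partial>M) = (\<Sum>s\<in>S. \<integral>y. h y \<partial>distr M N (g s))"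
    by (intro sum.cong refl) (simp add: integral_distr[OF g h(1)])
  finally show ?thesis .
qed

lemma measure_distr_pair_uniform_count:
  assumes M: "prob_space M" and S: "finite S" "S \<noteq> {}"
    and g: "\<And>s. s \<in> S \<Longrightarrow> g s \<in> measurable M N"
    and A: "A \<in> sets N"
  shows "measure (distr (M \<Otimes>\<^sub>M uniform_count_measure S) N (\<lambda>(x, s). g s x)) A
    = (\<Sum>s\<in>S. measure M (g s -` A \<inter> space M)) / real (card S)"
proof -
  have "(\<integral>y. indicator A y \<partial>distr (M \<Otimes>\<^sub>M uniform_count_measure S) N (\<lambda>(x, s). g s x))
    = (\<Sum>s\<in>S. \<integral>y. indicator A y \<partial>distr M N (g s)) / real (card S)"
    using A by (intro integral_distr_pair_uniform_count[where c = 1] M S g) auto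
  moreover have "A \<inter> space N = A" using sets.sets_into_space[OF A] by auto
  ultimately show ?thesis
    using A by (simp add: measure_distr[OF g])
qed

section \<open>Averages along maps with fibres of equal size\<close>

lemma sum_equal_fibres:
  fixes a :: "'b \<Rightarrow> real"
  assumes "finite S" "finite T" "\<phi> ` S \<subseteq> T" "\<And>t. t \<in> T \<Longrightarrow> card {s \<in> S. \<phi> s = t} = k"
  shows "(\<Sum>s\<in>S. a (\<phi> s)) = real k * (\<Sum>t\<in>T. a t)"
proof -
  have "(\<Sum>s\<in>S. a (\<phi> s)) = (\<Sum>t\<in>T. \<Sum>s\<in>{s \<in> S. \<phi> s = t}. a (\<phi> s))"
    by (rule sum.group[symmetric]) (use assms in auto)
  also have "\<dots> = (\<Sum>t\<in>T. real k * a t)"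
    using assms(4) by (intro sum.cong refl) simp
  finally show ?thesis by (simp add: sum_distrib_left)
qed

lemma average_equal_fibres:
  fixes a :: "'b \<Rightarrow> real"
  assumes "finite S" "S \<noteq> {}" "finite T" "\<phi> ` S \<subseteq> T" "\<And>t. t \<in> T \<Longrightarrow> card {s \<in> S. \<phi> s = t} = k"
  shows "(\<Sum>s\<in>S. a (\<phi> s)) / real (card S) = (\<Sum>t\<in>T. a t) / real (card T)"
proof -
  \<comment> \<open>The constant function 1 yields the size of \<open>S\<close>, so that the factor
    \<open>k\<close> cancels from the average.\<close>
  have "real (card S) = real k * real (card T)"
    using sum_equal_fibres[OF assms(1,3-), of "\<lambda>_. 1"] by simp
  moreover have "card S > 0" using assms by (simp add: card_gt_0_iff)
  ultimately show ?thesis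
    using sum_equal_fibres[OF assms(1,3-), of a] by auto
qed

lemma prob_space_eqI:
  assumes "prob_space P" "prob_space Q" "sets P = sets Q"
    and "\<And>A. A \<in> sets P \<Longrightarrow> measure P A = measure Q A"
  shows "P = Q"
proof (rule measure_eqI)
  interpret P: prob_space P by fact
  interpret Q: prob_space Q by fact
  fix A assume "A \<in> sets P"
  then show "emeasure P A = emeasure Q A"
    using assms(4) by (simp add: P.emeasure_eq_measure Q.emeasure_eq_measure)
qed fact

lemma distr_pair_uniform_count_equal_fibres:
  assumes M: "prob_space M" and S: "finite S" "S \<noteq> {}" and T: "finite T"
    and \<phi>: "\<phi> ` S \<subseteq> T" "\<And>t. t \<in> T \<Longrightarrow> card {s \<in> S. \<phi> s = t} = k"
    and g: "\<And>t. t \<in> T \<Longrightarrow> g t \<in> measurable M N"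
  shows "distr (M \<Otimes>\<^sub>M uniform_count_measure S) N (\<lambda>(x, s). g (\<phi> s) x)
    = distr (M \<Otimes>\<^sub>M uniform_count_measure T) N (\<lambda>(x, t). g t x)"
proof (rule prob_space_eqI)
  have T': "T \<noteq> {}" using S \<phi> by auto
  have g': "g (\<phi> s) \<in> measurable M N" if "s \<in> S" for s using that \<phi> g by blast
  show "prob_space (distr (M \<Otimes>\<^sub>M uniform_count_measure S) N (\<lambda>(x, s). g (\<phi> s) x))"
    by (rule prob_space_distr_pair_uniform_count[OF M S g'])
  show "prob_space (distr (M \<Otimes>\<^sub>M uniform_count_measure T) N (\<lambda>(x, t). g t x))"
    by (rule prob_space_distr_pair_uniform_count[OF M T T' g])
  fix A assume "A \<in> sets (distr (M \<Otimes>\<^sub>M uniform_count_measure S) N (\<lambda>(x, s). g (\<phi> s) x))"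
  then have A: "A \<in> sets N" by simp
  show "measure (distr (M \<Otimes>\<^sub>M uniform_count_measure S) N (\<lambda>(x, s). g (\<phi> s) x)) A
      = measure (distr (M \<Otimes>\<^sub>M uniform_count_measure T) N (\<lambda>(x, t). g t x)) A"
    using measure_distr_pair_uniform_count[of M S "\<lambda>s. g (\<phi> s)" N, OF M S g' A]
      measure_distr_pair_uniform_count[of M T g N, OF M T T' g A]
      average_equal_fibres[OF S T \<phi>, of "\<lambda>t. measure M (g t -` A \<inter> space M)"]
    by (simp only:)
qed simp

section \<open>Counting maps between finite sets\<close>

lemma fin_maps_finite: "finite (fin_maps m n)"
  by (simp add: finite_PiE)

lemma fin_maps_nonempty: "n \<ge> 1 \<Longrightarrow> fin_maps m n \<noteq> {}"
  by (auto simp: PiE_eq_empty_iff)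

lemma card_fin_maps: "card (fin_maps m n) = n ^ m"
  by (simp add: card_PiE)

lemma compose_in_fin_maps:
  "f \<in> fin_maps m n \<Longrightarrow> g \<in> fin_maps l m \<Longrightarrow> compose {1..l} f g \<in> fin_maps l n"
  by (auto simp: compose_def PiE_iff)

lemma incl_in_fin_maps: "m \<le> n \<Longrightarrow> incl m \<in> fin_maps m n"
  by (auto simp: incl_def)

lemma inj_on_incl: "inj_on (incl m) {1..m}"
  by (auto simp: inj_on_def incl_def)

lemma perm_map_in_fin_maps: "\<sigma> permutes {1..n} \<Longrightarrow> perm_map n \<sigma> \<in> fin_maps n n"
  unfolding perm_map_def by (rule PiE_I) (simp_all add: permutes_in_image del: atLeastAtMost_iff)

lemma inj_on_perm_map: "\<sigma> permutes {1..n} \<Longrightarrow> inj_on (perm_map n \<sigma>) {1..n}"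
  by (simp add: perm_map_def permutes_inj_on inj_on_restrict_eq)

text \<open>The fibre over \<open>i\<close> is the \<open>i\<close>-th block of \<open>k\<close>
  consecutive integers. Since indices start at 1, division acts on \<open>j - 1\<close>.\<close>

lemma card_equipart_fibre:
  assumes "n \<ge> 1" "k \<ge> 1" "i \<in> {1..n}"
  shows "card {j \<in> {1..n * k}. equipart n (n * k) j = i} = k"
proof -
  have "{j \<in> {1..n * k}. equipart n (n * k) j = i} = {k * (i - 1) + 1 .. k * (i - 1) + k}"
  proof (intro set_eqI iffI)
    fix j assume "j \<in> {j \<in> {1..n * k}. equipart n (n * k) j = i}"
    then have j: "j \<ge> 1" "(j - 1) div k = i - 1" using assms by (auto simp: equipart_def)
    have "k * (i - 1) + (j - 1) mod k = j - 1"
      using j(2) by (metis mult_div_mod_eq)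
    moreover have "(j - 1) mod k < k" using assms by simp
    ultimately show "j \<in> {k * (i - 1) + 1 .. k * (i - 1) + k}" using j(1) by auto
  next
    fix j assume j: "j \<in> {k * (i - 1) + 1 .. k * (i - 1) + k}"
    have "j = k * (i - 1) + (j - k * (i - 1))" "j - k * (i - 1) \<in> {1..k}" using j by auto
    then have "equipart n (n * k) j = i" using equipart_block[OF assms(3)] by metis
    moreover have "k * (i - 1) + k = k * i" using assms(3) by (cases i) auto
    then have "j \<le> n * k" using j assms(3)
      by (metis atLeastAtMost_iff le_trans mult.commute mult_le_mono1)
    ultimately show "j \<in> {j \<in> {1..n * k}. equipart n (n * k) j = i}" using j by auto
  qed
  then show ?thesis by simp
qed

lemma equipart_in_fin_maps:
  assumes "n \<ge> 1" "k \<ge> 1"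
  shows "equipart n (n * k) \<in> fin_maps (n * k) n"
proof (rule PiE_I)
  fix j assume j: "j \<in> {1..n * k}"
  have "(j - 1) div k < n"
    by (rule less_mult_imp_div_less) (use j in auto)
  then show "equipart n (n * k) j \<in> {1..n}" using j assms by (simp add: equipart_def)
qed (unfold equipart_def, auto)

text \<open>A solution \<open>F\<close> is chosen independently at each of the \<open>m\<close>
  points, with \<open>k\<close> choices in the fibre of \<open>d\<close> over
  \<open>G l\<close>.\<close>

lemma card_compose_fibre:
  assumes "d \<in> fin_maps N n" "\<And>i. i \<in> {1..n} \<Longrightarrow> card {j \<in> {1..N}. d j = i} = k"
    and G: "G \<in> fin_maps m n"
  shows "card {F \<in> fin_maps m N. compose {1..m} d F = G} = k ^ m"
proof -
  have "{F \<in> fin_maps m N. compose {1..m} d F = G} = (\<Pi>\<^sub>E l\<in>{1..m}. {j \<in> {1..N}. d j = G l})"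
  proof (intro set_eqI iffI)
    fix F assume F: "F \<in> (\<Pi>\<^sub>E l\<in>{1..m}. {j \<in> {1..N}. d j = G l})"
    then have "F \<in> fin_maps m N" by (auto simp: PiE_iff)
    moreover have "compose {1..m} d F = G"
      by (rule extensionalityI[of _ "{1..m}"])
         (use F G in \<open>auto simp: compose_def PiE_iff\<close>)
    ultimately show "F \<in> {F \<in> fin_maps m N. compose {1..m} d F = G}" by simp
  qed (auto simp: compose_def PiE_iff)
  moreover have "card (\<Pi>\<^sub>E l\<in>{1..m}. {j \<in> {1..N}. d j = G l}) = (\<Prod>l\<in>{1..m}. k)"
    unfolding card_PiE[OF finite_atLeastAtMost]
    by (rule prod.cong[OF refl], rule assms(2)) (use G in \<open>auto simp: PiE_iff\<close>)
  ultimately show ?thesis by simp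
qed

text \<open>The equation prescribes \<open>F\<close> on the image of \<open>g\<close>, consistently
  because \<open>g\<close> is injective, and leaves \<open>n\<close> choices at each of the
  \<open>m - l\<close> other points.\<close>

lemma card_precompose_fibre:
  assumes g: "g \<in> fin_maps l m" "inj_on g {1..l}" and G: "G \<in> fin_maps l n"
  shows "card {F \<in> fin_maps m n. compose {1..l} F g = G} = n ^ (m - l)"
proof -
  let ?R = "g ` {1..l}"
  let ?T = "\<lambda>i. if i \<in> ?R then {G (the_inv_into {1..l} g i)} else {1..n}"
  have g_mem: "g i \<in> {1..m}" if "i \<in> {1..l}" for i using g(1) that by (rule PiE_mem)
  have inv_g: "the_inv_into {1..l} g (g i) = i" if "i \<in> {1..l}" for i
    using g(2) that by (rule the_inv_into_f_f)
  have "{F \<in> fin_maps m n. compose {1..l} F g = G} = (\<Pi>\<^sub>E i\<in>{1..m}. ?T i)"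
  proof (intro set_eqI iffI)
    fix F assume "F \<in> {F \<in> fin_maps m n. compose {1..l} F g = G}"
    then have F: "F \<in> fin_maps m n" "compose {1..l} F g = G" by auto
    show "F \<in> (\<Pi>\<^sub>E i\<in>{1..m}. ?T i)"
    proof (rule PiE_I)
      fix i assume "i \<in> {1..m}"
      then have "F i \<in> {1..n}" by (rule PiE_mem[OF F(1)])
      moreover have "F (g i') = G i'" if "i' \<in> {1..l}" for i'
        using F(2) that by (auto simp: compose_def)
      ultimately show "F i \<in> ?T i" using inv_g by auto
    qed (use F in \<open>auto simp: PiE_iff extensional_def\<close>)
  next
    fix F assume F: "F \<in> (\<Pi>\<^sub>E i\<in>{1..m}. ?T i)"
    have Fi: "F i \<in> ?T i" if "i \<in> {1..m}" for i using F that by (rule PiE_mem)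
    have "F \<in> fin_maps m n"
    proof (rule PiE_I)
      fix i assume i: "i \<in> {1..m}"
      have "G (the_inv_into {1..l} g i) \<in> {1..n}" if "i \<in> ?R"
        by (rule PiE_mem[OF G], rule the_inv_into_into[OF g(2) that order_refl])
      then show "F i \<in> {1..n}" using Fi[OF i] by (auto split: if_splits)
    qed (use F in \<open>auto simp: PiE_iff extensional_def\<close>)
    moreover have "compose {1..l} F g = G"
    proof (rule extensionalityI[of _ "{1..l}"])
      fix i assume i: "i \<in> {1..l}"
      then show "compose {1..l} F g i = G i"
        using Fi[OF g_mem[OF i]] inv_g[OF i] by (auto simp: compose_eq)
    qed (use G in \<open>auto simp: PiE_iff\<close>)
    ultimately show "F \<in> {F \<in> fin_maps m n. compose {1..l} F g = G}" by simp
  qed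
  moreover have "card (\<Pi>\<^sub>E i\<in>{1..m}. ?T i) = (\<Prod>i\<in>{1..m}. if i \<in> ?R then 1 else n)"
    unfolding card_PiE[OF finite_atLeastAtMost] by (rule prod.cong) auto
  moreover have "(\<Prod>i\<in>{1..m}. if i \<in> ?R then 1 else n) = n ^ card ({1..m} - ?R)"
    by (simp add: prod.If_cases Diff_eq)
  moreover have "card ({1..m} - ?R) = m - l"
    using g_mem g(2) by (subst card_Diff_subset) (auto simp: card_image)
  ultimately show ?thesis by simp
qed

section \<open>Collisions and extension of injections\<close>

text \<open>The birthday bound: the product is the probability that \<open>m\<close> uniform draws
  from \<open>n\<close> values are distinct. Passing from \<open>m\<close> to \<open>m + 1\<close>
  draws adds at most \<open>m / n\<close> to the collision probability, because the earlier product
  is at most 1.\<close>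

lemma one_minus_prod_le:
  assumes "m \<le> n" "n \<ge> 1"
  shows "1 - (\<Prod>i<m. 1 - real i / real n) \<le> real m * (real m - 1) / (2 * real n)"
  using assms(1)
proof (induction m)
  case (Suc m)
  define P where "P = (\<Prod>i<m. 1 - real i / real n)"
  have "P \<le> 1" unfolding P_def
    by (rule prod_le_1) (use Suc.prems assms(2) in \<open>auto simp: field_simps\<close>)
  then have "P * (real m / real n) \<le> real m / real n"
    using mult_right_mono[of P 1 "real m / real n"] by simp
  then have "1 - P * (1 - real m / real n) \<le> 1 - P + real m / real n"
    by (simp add: algebra_simps)
  also have "\<dots> \<le> real m * (real m - 1) / (2 * real n) + real m / real n"
    using Suc by (simp add: P_def)
  also have "\<dots> = real (Suc m) * (real (Suc m) - 1) / (2 * real n)"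
    using assms(2) by (simp add: field_simps)
  finally show ?case by (simp add: P_def)
qed simp

lemma card_non_injective_le:
  assumes "m \<le> n" "n \<ge> 1"
  shows "real (card {f \<in> fin_maps m n. \<not> inj_on f {1..m}}) / real n ^ m
    \<le> real m * (real m - 1) / (2 * real n)"
proof -
  let ?I = "{f \<in> fin_maps m n. inj_on f {1..m}}"
  have fin: "finite (fin_maps m n)" by (simp add: finite_PiE)
  \<comment> \<open>The injections number \<open>n (n - 1) ... (n - m + 1)\<close>; dividing by
    \<open>n ^ m\<close> gives the birthday product.\<close>
  have "card ?I = (\<Prod>i = 0..<m. n - i)"
    using card_inj_on_subset_funcset[of "{1..m}" "{1..n}" "{1..m}"] by simp
  then have "real (card ?I) = (\<Prod>i<m. real n * (1 - real i / real n))"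
    using assms by (auto simp: lessThan_atLeast0 of_nat_diff algebra_simps intro!: prod.cong)
  also have "\<dots> = real n ^ m * (\<Prod>i<m. 1 - real i / real n)"
    unfolding prod.distrib by simp
  finally have I: "real (card ?I) = real n ^ m * (\<Prod>i<m. 1 - real i / real n)" .
  have "{f \<in> fin_maps m n. \<not> inj_on f {1..m}} = fin_maps m n - ?I" by auto
  then have "card {f \<in> fin_maps m n. \<not> inj_on f {1..m}} = card (fin_maps m n) - card ?I"
    using fin by (simp add: card_Diff_subset)
  moreover have "card ?I \<le> card (fin_maps m n)" using fin by (intro card_mono) auto
  moreover have "card (fin_maps m n) = n ^ m" by (simp add: card_PiE)
  ultimately have "real (card {f \<in> fin_maps m n. \<not> inj_on f {1..m}})
      = real n ^ m * (1 - (\<Prod>i<m. 1 - real i / real n))"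
    using I by (simp add: of_nat_diff algebra_simps)
  then show ?thesis using one_minus_prod_le[OF assms] assms(2) by simp
qed

text \<open>The complements of \<open>[m]\<close> and of its image in \<open>[n]\<close> have the
  same size, so \<open>f\<close> is glued to a bijection between them.\<close>

lemma injective_extends_to_permutation:
  assumes f: "f \<in> fin_maps m n" "inj_on f {1..m}" and mn: "m \<le> n"
  obtains \<sigma> where "\<sigma> permutes {1..n}" "\<And>i. i \<in> {1..m} \<Longrightarrow> \<sigma> i = f i"
proof -
  have img: "f ` {1..m} \<subseteq> {1..n}" using f(1) by (auto simp: PiE_iff)
  have "card ({1..n} - {1..m}) = card ({1..n} - f ` {1..m})"
    using mn img f(2) by (simp add: card_Diff_subset card_image)
  then obtain g where g: "bij_betw g ({1..n} - {1..m}) ({1..n} - f ` {1..m})"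
    using finite_same_card_bij[of "{1..n} - {1..m}" "{1..n} - f ` {1..m}"] by auto
  define \<sigma> where "\<sigma> i = (if i \<in> {1..m} then f i else if i \<in> {1..n} then g i else i)" for i
  have "bij_betw \<sigma> {1..m} (f ` {1..m})"
    by (rule bij_betw_cong[THEN iffD1, OF _ inj_on_imp_bij_betw[OF f(2)]]) (simp add: \<sigma>_def)
  moreover have "bij_betw \<sigma> ({1..n} - {1..m}) ({1..n} - f ` {1..m})"
    by (rule bij_betw_cong[THEN iffD1, OF _ g]) (simp add: \<sigma>_def)
  ultimately have "bij_betw \<sigma> ({1..m} \<union> ({1..n} - {1..m})) (f ` {1..m} \<union> ({1..n} - f ` {1..m}))"
    by (rule bij_betw_combine) auto
  moreover have "{1..m} \<union> ({1..n} - {1..m}) = {1..n}" using mn by auto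
  moreover have "f ` {1..m} \<union> ({1..n} - f ` {1..m}) = {1..n}" using img by auto
  ultimately have "\<sigma> permutes {1..n}"
    by (intro bij_imp_permutes) (use mn in \<open>auto simp: \<sigma>_def\<close>)
  moreover have "\<sigma> i = f i" if "i \<in> {1..m}" for i using that by (simp add: \<sigma>_def)
  ultimately show ?thesis using that by blast
qed

section \<open>Laws of random restrictions\<close>

text \<open>The family \<open>\<Omega>\<close> is a locale parameter so that the results apply both
  to the given subsets and to the full spaces \<open>V n\<close>, on which the total variation bound
  is claimed.\<close>

locale finset_op_spaces = finset_op_rep V \<tau> ip
  for V :: "nat \<Rightarrow> 'v::real_normed_vector set"
    and \<tau> :: "nat \<Rightarrow> nat \<Rightarrow> (nat \<Rightarrow> nat) \<Rightarrow> 'v \<Rightarrow> 'v"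
    and ip :: "nat \<Rightarrow> 'v \<Rightarrow> 'v \<Rightarrow> real" +
  fixes \<Omega> :: "nat \<Rightarrow> 'v set"
  assumes \<Omega>_subset: "n \<ge> 1 \<Longrightarrow> \<Omega> n \<subseteq> V n"
    and \<Omega>_closed: "m \<ge> 1 \<Longrightarrow> n \<ge> 1 \<Longrightarrow> f \<in> fin_maps m n \<Longrightarrow> \<tau> m n f ` \<Omega> n \<subseteq> \<Omega> m"
begin

section \<open>Measurability of the structure maps\<close>

lemma \<tau>_continuous:
  assumes "m \<ge> 1" "n \<ge> 1" "f \<in> fin_maps m n"
  shows "continuous_on (V n) (\<tau> m n f)"
proof -
  obtain B where B: "finite B" "span B = V n" using V_finite_dim[OF assms(2)] by blast
  show ?thesis
    unfolding B(2)[symmetric]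
    by (rule linear_on_finite_span_continuous[OF B(1)]; unfold B(2))
       (rule \<tau>_add[OF assms] \<tau>_scale[OF assms]; assumption)+
qed

lemma \<tau>_measurable:
  assumes "m \<ge> 1" "n \<ge> 1" "f \<in> fin_maps m n"
  shows "\<tau> m n f \<in> measurable (borel_on (\<Omega> n)) (borel_on (\<Omega> m))"
proof (rule measurable_restrict_space2)
  show "\<tau> m n f \<in> space (borel_on (\<Omega> n)) \<rightarrow> \<Omega> m"
    using \<Omega>_closed[OF assms] by (auto simp: space_restrict_space)
  show "\<tau> m n f \<in> borel_measurable (borel_on (\<Omega> n))"
    by (rule borel_measurable_continuous_on_restrict,
        rule continuous_on_subset[OF \<tau>_continuous[OF assms] \<Omega>_subset[OF assms(2)]])
qed

lemma \<tau>_measurable_probs: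
  assumes "\<mu> \<in> borel_probs (\<Omega> n)" "m \<ge> 1" "n \<ge> 1" "f \<in> fin_maps m n"
  shows "\<tau> m n f \<in> measurable \<mu> (borel_on (\<Omega> m))"
proof -
  have "sets \<mu> = sets (borel_on (\<Omega> n))" using assms(1) by (simp add: borel_probs_def)
  from measurable_cong_sets[OF this refl] show ?thesis
    using \<tau>_measurable[OF assms(2-4)] by metis
qed

lemma space_borel_probs: "\<mu> \<in> borel_probs (\<Omega> n) \<Longrightarrow> space \<mu> = \<Omega> n"
  using sets_eq_imp_space_eq[of \<mu> "borel_on (\<Omega> n)"] by (simp add: borel_probs_def space_restrict_space)

lemma prob_space_borel_probs: "\<mu> \<in> borel_probs S \<Longrightarrow> prob_space \<mu>"
  by (simp add: borel_probs_def)

lemma inv_probs_borel_probs: "\<mu> \<in> inv_probs \<tau> S n \<Longrightarrow> \<mu> \<in> borel_probs (S n)"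
  by (simp add: inv_probs_def)

lemma \<tau>_comp_\<Omega>:
  assumes "l \<ge> 1" "m \<ge> 1" "n \<ge> 1" "f \<in> fin_maps m n" "g \<in> fin_maps l m" "x \<in> \<Omega> n"
  shows "\<tau> l m g (\<tau> m n f x) = \<tau> l n (compose {1..l} f g) x"
  by (rule \<tau>_comp[OF assms(1-5) subsetD[OF \<Omega>_subset[OF assms(3)] assms(6)], symmetric])

lemma law_random_map_borel_probs:
  assumes "\<mu> \<in> borel_probs (\<Omega> n)" "m \<ge> 1" "n \<ge> 1"
  shows "law_random_map \<tau> \<Omega> m n \<mu> \<in> borel_probs (\<Omega> m)"
  unfolding law_random_map_def borel_probs_def mem_Collect_eq
  by (intro conjI prob_space_distr_pair_uniform_count fin_maps_finite fin_maps_nonempty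
      \<tau>_measurable_probs prob_space_borel_probs[OF assms(1)] assms) simp_all

lemma measure_law_random_map:
  assumes "\<mu> \<in> borel_probs (\<Omega> n)" "m \<ge> 1" "n \<ge> 1" "A \<in> sets (borel_on (\<Omega> m))"
  shows "measure (law_random_map \<tau> \<Omega> m n \<mu>) A
    = (\<Sum>f\<in>fin_maps m n. measure \<mu> (\<tau> m n f -` A \<inter> \<Omega> n)) / real (card (fin_maps m n))"
  using measure_distr_pair_uniform_count[OF prob_space_borel_probs[OF assms(1)] fin_maps_finite
      fin_maps_nonempty[OF assms(3)] \<tau>_measurable_probs[OF assms(1-3)] assms(4)]
  unfolding law_random_map_def space_borel_probs[OF assms(1)] .

section \<open>Invariance and consistency of the laws of random restrictions\<close>

text \<open>Functoriality merges \<open>\<tau>\<close> along \<open>F\<close> and then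
  \<open>g\<close> into \<open>\<tau>\<close> along \<open>F\<close> after \<open>g\<close>, which
  is uniform on the maps from \<open>[l]\<close> to \<open>[n]\<close> because \<open>g\<close> is
  injective. Permutations as \<open>g\<close> give invariance; inclusions give consistency in the
  inverse limit.\<close>

lemma distr_law_random_map_injective:
  assumes \<mu>: "\<mu> \<in> borel_probs (\<Omega> n)" and pos: "l \<ge> 1" "m \<ge> 1" "n \<ge> 1"
    and g: "g \<in> fin_maps l m" "inj_on g {1..l}"
  shows "distr (law_random_map \<tau> \<Omega> m n \<mu>) (borel_on (\<Omega> l)) (\<tau> l m g) = law_random_map \<tau> \<Omega> l n \<mu>"
proof -
  let ?U = "uniform_count_measure (fin_maps m n)"
  have meas: "(\<lambda>(x, F). \<tau> m n F x) \<in> measurable (\<mu> \<Otimes>\<^sub>M ?U) (borel_on (\<Omega> m))"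
    by (rule measurable_pair_uniform_count[OF fin_maps_finite \<tau>_measurable_probs[OF \<mu> pos(2,3)]])
  have "distr (law_random_map \<tau> \<Omega> m n \<mu>) (borel_on (\<Omega> l)) (\<tau> l m g)
      = distr (\<mu> \<Otimes>\<^sub>M ?U) (borel_on (\<Omega> l)) (\<tau> l m g \<circ> (\<lambda>(x, F). \<tau> m n F x))"
    unfolding law_random_map_def by (rule distr_distr[OF \<tau>_measurable[OF pos(1,2) g(1)] meas])
  also have "\<dots> = distr (\<mu> \<Otimes>\<^sub>M ?U) (borel_on (\<Omega> l)) (\<lambda>(x, F). \<tau> l n (compose {1..l} F g) x)"
  proof (intro distr_cong refl)
    fix z assume "z \<in> space (\<mu> \<Otimes>\<^sub>M ?U)"
    then have "fst z \<in> \<Omega> n" "snd z \<in> fin_maps m n"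
      by (simp_all only: space_pair_measure space_uniform_count_measure space_borel_probs[OF \<mu>]
          mem_Times_iff)
    from \<tau>_comp_\<Omega>[OF pos this(2) g(1) this(1)]
    show "(\<tau> l m g \<circ> (\<lambda>(x, F). \<tau> m n F x)) z = (case z of (x, F) \<Rightarrow> \<tau> l n (compose {1..l} F g) x)"
      unfolding split_beta comp_apply .
  qed
  also have "\<dots> = law_random_map \<tau> \<Omega> l n \<mu>"
    unfolding law_random_map_def
  proof (rule distr_pair_uniform_count_equal_fibres[where \<phi> = "\<lambda>F. compose {1..l} F g" and g = "\<tau> l n"])
    show "(\<lambda>F. compose {1..l} F g) ` fin_maps m n \<subseteq> fin_maps l n"
      by (rule image_subsetI, rule compose_in_fin_maps[OF _ g(1)])
    show "card {F \<in> fin_maps m n. compose {1..l} F g = G} = n ^ (m - l)" if "G \<in> fin_maps l n" for G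
      by (rule card_precompose_fibre[OF g that])
  qed (rule fin_maps_finite fin_maps_nonempty[OF pos(3)] prob_space_borel_probs[OF \<mu>]
      \<tau>_measurable_probs[OF \<mu> pos(1,3)]; assumption?)+
  finally show ?thesis .
qed

lemma law_random_map_inv_probs:
  assumes "\<mu> \<in> borel_probs (\<Omega> n)" "m \<ge> 1" "n \<ge> 1"
  shows "law_random_map \<tau> \<Omega> m n \<mu> \<in> inv_probs \<tau> \<Omega> m"
  unfolding inv_probs_def perm_act_def
proof (intro CollectI conjI allI impI)
  fix \<sigma> assume "\<sigma> permutes {1..m}"
  then have "inv \<sigma> permutes {1..m}" by (rule permutes_inv)
  then show "distr (law_random_map \<tau> \<Omega> m n \<mu>) (borel_on (\<Omega> m)) (\<tau> m m (perm_map m (inv \<sigma>)))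
      = law_random_map \<tau> \<Omega> m n \<mu>"
    by (intro distr_law_random_map_injective[OF assms(1,2,2,3) perm_map_in_fin_maps inj_on_perm_map])
qed (rule law_random_map_borel_probs[OF assms])

lemma law_seq_inv_limit:
  assumes "\<mu> \<in> borel_probs (\<Omega> n)" "n \<ge> 1"
  shows "law_seq \<tau> \<Omega> (n, \<mu>) \<in> inv_limit \<tau> \<Omega>"
  unfolding inv_limit_def
proof (intro CollectI conjI allI impI)
  show "law_seq \<tau> \<Omega> (n, \<mu>) \<in> (\<Pi>\<^sub>E m\<in>{1..}. inv_probs \<tau> \<Omega> m)"
    unfolding law_seq_def fst_conv snd_conv restrict_PiE_iff
    by (intro ballI law_random_map_inv_probs assms) (simp only: atLeast_iff)
  fix m M :: nat assume m: "1 \<le> m" "m \<le> M"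
  then show "law_incl \<tau> \<Omega> m M (law_seq \<tau> \<Omega> (n, \<mu>) M) = law_seq \<tau> \<Omega> (n, \<mu>) m"
    using distr_law_random_map_injective[OF assms(1) m(1) _ assms(2) incl_in_fin_maps inj_on_incl]
    by (simp add: law_incl_def law_seq_def)
qed

section \<open>Independence of the representative in the direct limit\<close>

text \<open>Symmetrizing after the embedding amounts to pulling back along one map, the
  equipartition precomposed with \<open>inv \<sigma>\<close>.\<close>

lemma perm_act_equipart:
  assumes "n \<ge> 1" "k \<ge> 1" "\<sigma> permutes {1..n * k}" "x \<in> \<Omega> n"
  shows "perm_act \<tau> (n * k) \<sigma> (\<tau> (n * k) n (equipart n (n * k)) x)
    = \<tau> (n * k) n (compose {1..n * k} (equipart n (n * k)) (perm_map (n * k) (inv \<sigma>))) x"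
proof -
  have "n * k \<ge> 1" using assms(1,2) by (cases n; cases k) auto
  from \<tau>_comp_\<Omega>[OF this this assms(1) equipart_in_fin_maps[OF assms(1,2)]
      perm_map_in_fin_maps[OF permutes_inv[OF assms(3)]] assms(4)]
  show ?thesis unfolding perm_act_def .
qed

text \<open>Each fibre is the image under \<open>\<sigma>\<close> of a fibre of the standard
  equipartition.\<close>

lemma card_permuted_equipart_fibre:
  assumes "n \<ge> 1" "k \<ge> 1" "\<sigma> permutes {1..n * k}" "i \<in> {1..n}"
  shows "card {j \<in> {1..n * k}. compose {1..n * k} (equipart n (n * k)) (perm_map (n * k) (inv \<sigma>)) j = i} = k"
proof -
  let ?N = "n * k"
  have "{j \<in> {1..?N}. compose {1..?N} (equipart n ?N) (perm_map ?N (inv \<sigma>)) j = i}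
      = {j \<in> {1..?N}. equipart n ?N (inv \<sigma> j) = i}"
    by (auto simp: compose_def perm_map_def)
  also have "\<dots> = \<sigma> ` {j \<in> {1..?N}. equipart n ?N j = i}"
  proof (intro set_eqI iffI)
    fix j assume j: "j \<in> {j \<in> {1..?N}. equipart n ?N (inv \<sigma> j) = i}"
    then have "inv \<sigma> j \<in> {1..?N}" using permutes_in_image[OF permutes_inv[OF assms(3)]] by blast
    moreover have "j = \<sigma> (inv \<sigma> j)" using permutes_inverses(1)[OF assms(3)] by simp
    ultimately show "j \<in> \<sigma> ` {j \<in> {1..?N}. equipart n ?N j = i}" using j by blast
  next
    fix j assume "j \<in> \<sigma> ` {j \<in> {1..?N}. equipart n ?N j = i}"
    then show "j \<in> {j \<in> {1..?N}. equipart n ?N (inv \<sigma> j) = i}"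
      using permutes_in_image[OF assms(3)] permutes_inverses(2)[OF assms(3)] by auto
  qed
  also have "card \<dots> = card {j \<in> {1..?N}. equipart n ?N j = i}"
    by (rule card_image[OF permutes_inj_on[OF assms(3)]])
  also have "\<dots> = k" by (rule card_equipart_fibre[OF assms(1,2,4)])
  finally show ?thesis .
qed

text \<open>Both sides are compared on a measurable set. The left side is a double average over
  \<open>F\<close> and \<open>\<sigma>\<close>; once the sums are exchanged, the average over
  \<open>F\<close> is the same for every \<open>\<sigma>\<close> and equals the right side.\<close>

lemma law_random_map_sym_embed:
  assumes \<mu>: "\<mu> \<in> borel_probs (\<Omega> n)" and pos: "m \<ge> 1" "n \<ge> 1" "N \<ge> 1" and dvd: "n dvd N"
  shows "law_random_map \<tau> \<Omega> m N (sym_embed \<tau> \<Omega> n N \<mu>) = law_random_map \<tau> \<Omega> m n \<mu>"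
proof -
  obtain k where N: "N = n * k" using dvd by blast
  have k: "k \<ge> 1" using N pos by (cases k) auto
  let ?S = "{\<sigma>. \<sigma> permutes {1..N}}"
  let ?d = "\<lambda>\<sigma>. compose {1..N} (equipart n N) (perm_map N (inv \<sigma>))"
  have S: "finite ?S" "?S \<noteq> {}" using finite_permutations permutes_id by (blast intro: finite_atLeastAtMost)+
  have d: "?d \<sigma> \<in> fin_maps N n" if "\<sigma> \<in> ?S" for \<sigma>
    using that unfolding N mem_Collect_eq
    by (rule compose_in_fin_maps[OF equipart_in_fin_maps[OF pos(2) k]
          perm_map_in_fin_maps[OF permutes_inv]])
  have sym: "sym_embed \<tau> \<Omega> n N \<mu>
      = distr (\<mu> \<Otimes>\<^sub>M uniform_count_measure ?S) (borel_on (\<Omega> N)) (\<lambda>(x, \<sigma>). \<tau> N n (?d \<sigma>) x)"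
    unfolding sym_embed_def
  proof (intro distr_cong refl)
    fix z assume "z \<in> space (\<mu> \<Otimes>\<^sub>M uniform_count_measure ?S)"
    then have "fst z \<in> \<Omega> n" "snd z permutes {1..N}"
      by (simp_all only: space_pair_measure space_uniform_count_measure space_borel_probs[OF \<mu>]
          mem_Times_iff mem_Collect_eq)
    from perm_act_equipart[OF pos(2) k this(2)[unfolded N] this(1)]
    show "(case z of (x, \<sigma>) \<Rightarrow> perm_act \<tau> N \<sigma> (\<tau> N n (equipart n N) x))
        = (case z of (x, \<sigma>) \<Rightarrow> \<tau> N n (?d \<sigma>) x)"
      unfolding split_beta N .
  qed
  have d_meas: "\<tau> N n (?d \<sigma>) \<in> measurable \<mu> (borel_on (\<Omega> N))" if "\<sigma> \<in> ?S" for \<sigma>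
    by (rule \<tau>_measurable_probs[OF \<mu> pos(3,2) d[OF that]])
  have sym_prob: "sym_embed \<tau> \<Omega> n N \<mu> \<in> borel_probs (\<Omega> N)"
    unfolding sym borel_probs_def
    using prob_space_distr_pair_uniform_count[OF prob_space_borel_probs[OF \<mu>] S d_meas] by simp
  show ?thesis
  proof (rule prob_space_eqI)
    show "prob_space (law_random_map \<tau> \<Omega> m N (sym_embed \<tau> \<Omega> n N \<mu>))"
      by (rule prob_space_borel_probs[OF law_random_map_borel_probs[OF sym_prob pos(1,3)]])
    show "prob_space (law_random_map \<tau> \<Omega> m n \<mu>)"
      by (rule prob_space_borel_probs[OF law_random_map_borel_probs[OF \<mu> pos(1,2)]])
    show "sets (law_random_map \<tau> \<Omega> m N (sym_embed \<tau> \<Omega> n N \<mu>)) = sets (law_random_map \<tau> \<Omega> m n \<mu>)"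
      by (simp add: law_random_map_def)
    fix A assume "A \<in> sets (law_random_map \<tau> \<Omega> m N (sym_embed \<tau> \<Omega> n N \<mu>))"
    then have A: "A \<in> sets (borel_on (\<Omega> m))" by (simp add: law_random_map_def)
    \<comment> \<open>\<open>a G\<close> is the probability that pulling back a
      \<open>\<mu>\<close>-random point along \<open>G\<close> lands in \<open>A\<close>; both sides
      become averages of \<open>a\<close>.\<close>
    define a where "a G = measure \<mu> (\<tau> m n G -` A \<inter> \<Omega> n)" for G
    have step: "measure (sym_embed \<tau> \<Omega> n N \<mu>) (\<tau> m N F -` A \<inter> \<Omega> N)
        = (\<Sum>\<sigma>\<in>?S. a (compose {1..m} (?d \<sigma>) F)) / real (card ?S)" if F: "F \<in> fin_maps m N" for F
    proof -
      have "\<tau> m N F -` A \<inter> \<Omega> N \<in> sets (borel_on (\<Omega> N))"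
        using measurable_sets[OF \<tau>_measurable[OF pos(1,3) F] A] by (simp add: space_restrict_space)
      from measure_distr_pair_uniform_count[where g = "\<lambda>\<sigma>. \<tau> N n (?d \<sigma>)",
          OF prob_space_borel_probs[OF \<mu>] S d_meas this]
      have "measure (sym_embed \<tau> \<Omega> n N \<mu>) (\<tau> m N F -` A \<inter> \<Omega> N)
          = (\<Sum>\<sigma>\<in>?S. measure \<mu> (\<tau> N n (?d \<sigma>) -` (\<tau> m N F -` A \<inter> \<Omega> N) \<inter> space \<mu>)) / real (card ?S)"
        unfolding sym .
      also have "(\<Sum>\<sigma>\<in>?S. measure \<mu> (\<tau> N n (?d \<sigma>) -` (\<tau> m N F -` A \<inter> \<Omega> N) \<inter> space \<mu>))
          = (\<Sum>\<sigma>\<in>?S. a (compose {1..m} (?d \<sigma>) F))"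
      proof (rule sum.cong[OF refl])
        fix \<sigma> assume \<sigma>: "\<sigma> \<in> ?S"
        have "\<tau> N n (?d \<sigma>) x \<in> \<Omega> N" if "x \<in> \<Omega> n" for x
          using \<Omega>_closed[OF pos(3,2) d[OF \<sigma>]] that by blast
        moreover have "\<tau> m N F (\<tau> N n (?d \<sigma>) x) = \<tau> m n (compose {1..m} (?d \<sigma>) F) x" if "x \<in> \<Omega> n" for x
          by (rule \<tau>_comp_\<Omega>[OF pos(1,3,2) d[OF \<sigma>] F that])
        ultimately have "\<tau> N n (?d \<sigma>) -` (\<tau> m N F -` A \<inter> \<Omega> N) \<inter> space \<mu>
            = \<tau> m n (compose {1..m} (?d \<sigma>) F) -` A \<inter> \<Omega> n"
          unfolding space_borel_probs[OF \<mu>] by auto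
        then show "measure \<mu> (\<tau> N n (?d \<sigma>) -` (\<tau> m N F -` A \<inter> \<Omega> N) \<inter> space \<mu>)
            = a (compose {1..m} (?d \<sigma>) F)"
          by (simp add: a_def)
      qed
      finally show ?thesis .
    qed
    \<comment> \<open>Postcomposition with the equipartition permuted by a fixed
      \<open>\<sigma>\<close> has all fibres of size \<open>k ^ m\<close>, so it carries the uniform
      \<open>F\<close> to a uniform \<open>G\<close>.\<close>
    have avg: "(\<Sum>F\<in>fin_maps m N. a (compose {1..m} (?d \<sigma>) F)) / real (card (fin_maps m N))
        = (\<Sum>G\<in>fin_maps m n. a G) / real (card (fin_maps m n))" if \<sigma>: "\<sigma> \<in> ?S" for \<sigma>
    proof (rule average_equal_fibres)
      show "compose {1..m} (?d \<sigma>) ` fin_maps m N \<subseteq> fin_maps m n"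
        by (rule image_subsetI, rule compose_in_fin_maps[OF d[OF \<sigma>]])
      fix G assume "G \<in> fin_maps m n"
      then show "card {F \<in> fin_maps m N. compose {1..m} (?d \<sigma>) F = G} = k ^ m"
        using card_permuted_equipart_fibre[OF pos(2) k] \<sigma>
        by (intro card_compose_fibre[OF d[OF \<sigma>]]) (auto simp: N)
    qed (intro fin_maps_finite fin_maps_nonempty pos)+
    have "measure (law_random_map \<tau> \<Omega> m N (sym_embed \<tau> \<Omega> n N \<mu>)) A
        = (\<Sum>F\<in>fin_maps m N. (\<Sum>\<sigma>\<in>?S. a (compose {1..m} (?d \<sigma>) F)) / real (card ?S))
          / real (card (fin_maps m N))"
      unfolding measure_law_random_map[OF sym_prob pos(1,3) A]
      by (intro arg_cong2[where f = "(/)"] sum.cong refl step)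
    also have "\<dots> = (\<Sum>\<sigma>\<in>?S. (\<Sum>F\<in>fin_maps m N. a (compose {1..m} (?d \<sigma>) F)) / real (card (fin_maps m N)))
        / real (card ?S)"
      by (subst (1 2) sum_divide_distrib[symmetric], subst sum.swap) (simp add: mult.commute)
    also have "\<dots> = (\<Sum>\<sigma>\<in>?S. (\<Sum>G\<in>fin_maps m n. a G) / real (card (fin_maps m n))) / real (card ?S)"
      by (intro arg_cong2[where f = "(/)"] sum.cong refl avg)
    also have "\<dots> = measure (law_random_map \<tau> \<Omega> m n \<mu>) A"
      unfolding measure_law_random_map[OF \<mu> pos(1,2) A] a_def
      using S by (simp add: card_gt_0_iff del: card_PiE)
    finally show "measure (law_random_map \<tau> \<Omega> m N (sym_embed \<tau> \<Omega> n N \<mu>)) A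
        = measure (law_random_map \<tau> \<Omega> m n \<mu>) A" .
  qed
qed

lemma law_seq_dir_step: "dir_step \<tau> \<Omega> p q \<Longrightarrow> law_seq \<tau> \<Omega> p = law_seq \<tau> \<Omega> q"
proof (induction rule: dir_step.induct)
  case (1 n N \<mu>)
  then show ?case
    unfolding law_seq_def
    by (intro restrict_ext) (simp add: law_random_map_sym_embed inv_probs_borel_probs)
qed

lemma law_seq_equivclp:
  assumes "equivclp (dir_step \<tau> \<Omega>) p q"
  shows "law_seq \<tau> \<Omega> p = law_seq \<tau> \<Omega> q"
  using assms by (induction rule: equivclp_induct) (auto dest: law_seq_dir_step)

text \<open>Well-definedness: the image of a class under \<open>law_seq\<close> is a singleton,
  which gives \<open>the_elem\<close> its meaning.\<close>

lemma limit_map_class: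
  assumes "p \<in> dir_union \<tau> \<Omega>"
  shows "limit_map \<tau> \<Omega> (dir_rel \<tau> \<Omega> `` {p}) = law_seq \<tau> \<Omega> p"
proof -
  have "p \<in> dir_rel \<tau> \<Omega> `` {p}" using assms by (simp add: dir_rel_def)
  moreover have "law_seq \<tau> \<Omega> q = law_seq \<tau> \<Omega> p" if "q \<in> dir_rel \<tau> \<Omega> `` {p}" for q
    using that law_seq_equivclp[of p q] by (simp add: dir_rel_def)
  ultimately have "law_seq \<tau> \<Omega> ` (dir_rel \<tau> \<Omega> `` {p}) = {law_seq \<tau> \<Omega> p}" by blast
  then show ?thesis by (simp add: limit_map_def)
qed

lemma limit_map_in_inv_limit: "limit_map \<tau> \<Omega> \<in> dir_limit \<tau> \<Omega> \<rightarrow> inv_limit \<tau> \<Omega>"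
proof
  fix c assume "c \<in> dir_limit \<tau> \<Omega>"
  then obtain p where p: "p \<in> dir_union \<tau> \<Omega>" "c = dir_rel \<tau> \<Omega> `` {p}"
    by (auto simp: dir_limit_def elim: quotientE)
  obtain n \<mu> where "p = (n, \<mu>)" "n \<ge> 1" "\<mu> \<in> inv_probs \<tau> \<Omega> n"
    using p(1) by (auto simp: dir_union_def)
  then show "limit_map \<tau> \<Omega> c \<in> inv_limit \<tau> \<Omega>"
    using limit_map_class[OF p(1)] p(2) by (simp add: law_seq_inv_limit inv_probs_borel_probs)
qed

section \<open>Total variation bound and density\<close>

lemma distr_injective:
  assumes \<mu>: "\<mu> \<in> inv_probs \<tau> \<Omega> n" and mn: "1 \<le> m" "m \<le> n"
    and f: "f \<in> fin_maps m n" "inj_on f {1..m}"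
  shows "distr \<mu> (borel_on (\<Omega> m)) (\<tau> m n f) = law_incl \<tau> \<Omega> m n \<mu>"
proof -
  have n: "n \<ge> 1" using mn by simp
  note \<mu>' = inv_probs_borel_probs[OF \<mu>]
  obtain \<sigma> where \<sigma>: "\<sigma> permutes {1..n}" "\<And>i. i \<in> {1..m} \<Longrightarrow> \<sigma> i = f i"
    using injective_extends_to_permutation[OF f mn(2)] by blast
  have comp: "compose {1..m} (perm_map n \<sigma>) (incl m) = f"
    by (rule extensionalityI[of _ "{1..m}"])
       (use f \<sigma>(2) mn in \<open>auto simp: compose_def perm_map_def incl_def PiE_iff\<close>)
  \<comment> \<open>The left action pulls back along the inverse, so invariance has to be applied to
    \<open>inv \<sigma>\<close> to obtain the pullback along \<open>\<sigma>\<close> itself.\<close>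
  have act: "perm_act \<tau> n (inv \<sigma>) = \<tau> n n (perm_map n \<sigma>)"
    by (simp add: perm_act_def[abs_def] inv_inv_eq[OF permutes_bij[OF \<sigma>(1)]])
  have "law_incl \<tau> \<Omega> m n \<mu>
      = distr (distr \<mu> (borel_on (\<Omega> n)) (\<tau> n n (perm_map n \<sigma>))) (borel_on (\<Omega> m)) (\<tau> m n (incl m))"
    using \<mu> permutes_inv[OF \<sigma>(1)] by (simp add: law_incl_def inv_probs_def act[symmetric])
  also have "\<dots> = distr \<mu> (borel_on (\<Omega> m)) (\<tau> m n (incl m) \<circ> \<tau> n n (perm_map n \<sigma>))"
    by (intro distr_distr \<tau>_measurable \<tau>_measurable_probs \<mu>' mn n incl_in_fin_maps
        perm_map_in_fin_maps \<sigma>(1))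
  also have "\<dots> = distr \<mu> (borel_on (\<Omega> m)) (\<tau> m n f)"
  proof (intro distr_cong refl)
    fix x assume "x \<in> space \<mu>"
    then have "x \<in> \<Omega> n" by (simp add: space_borel_probs[OF \<mu>'])
    from \<tau>_comp_\<Omega>[OF mn(1) n n perm_map_in_fin_maps[OF \<sigma>(1)] incl_in_fin_maps[OF mn(2)] this]
    show "(\<tau> m n (incl m) \<circ> \<tau> n n (perm_map n \<sigma>)) x = \<tau> m n f x"
      unfolding comp comp_apply .
  qed
  finally show ?thesis ..
qed

text \<open>For each test function the difference of expectations is an average over all maps of
  terms that vanish at injections and are at most 2 elsewhere. Nonnegativity is recorded for the
  squeeze argument in the density proof.\<close>

lemma tv_dist_law_bounds:
  assumes \<mu>: "\<mu> \<in> inv_probs \<tau> \<Omega> n" and mn: "1 \<le> m" "m \<le> n"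
  shows "0 \<le> tv_dist (law_incl \<tau> \<Omega> m n \<mu>) (law_random_map \<tau> \<Omega> m n \<mu>)"
    and "tv_dist (law_incl \<tau> \<Omega> m n \<mu>) (law_random_map \<tau> \<Omega> m n \<mu>) \<le> real m * (real m - 1) / real n"
proof -
  have n: "n \<ge> 1" using mn by simp
  note \<mu>' = inv_probs_borel_probs[OF \<mu>]
  let ?P = "law_incl \<tau> \<Omega> m n \<mu>" and ?Q = "law_random_map \<tau> \<Omega> m n \<mu>"
  let ?B = "borel_on (\<Omega> m)"
  let ?H = "{h \<in> borel_measurable ?P. \<forall>x\<in>space ?P. h x \<in> {-1..1::real}}"
  let ?N = "{f \<in> fin_maps m n. \<not> inj_on f {1..m}}"
  have meas: "\<tau> m n f \<in> measurable \<mu> ?B" if "f \<in> fin_maps m n" for f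
    by (rule \<tau>_measurable_probs[OF \<mu>' mn(1) n that])
  have bound: "\<bar>(\<integral>x. h x \<partial>?P) - (\<integral>x. h x \<partial>?Q)\<bar> \<le> real m * (real m - 1) / real n"
    if "h \<in> ?H" for h :: "'v \<Rightarrow> real"
  proof -
    have h: "h \<in> borel_measurable ?B" "\<And>y. y \<in> space ?B \<Longrightarrow> \<bar>h y\<bar> \<le> 1"
      using that by (auto simp: law_incl_def abs_le_iff)
    \<comment> \<open>\<open>D f\<close> is the expectation of \<open>h\<close> under the pullback
      along the fixed map \<open>f\<close>: the first law has expectation \<open>D (incl m)\<close>,
      the second the average of all \<open>D f\<close>.\<close>
    define D where "D f = (\<integral>y. h y \<partial>distr \<mu> ?B (\<tau> m n f))" for f
    have D_le: "\<bar>D f\<bar> \<le> 1" if f: "f \<in> fin_maps m n" for f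
    proof -
      interpret prob_space "distr \<mu> ?B (\<tau> m n f)"
        by (rule prob_space.prob_space_distr[OF prob_space_borel_probs[OF \<mu>'] meas[OF f]])
      have ae: "AE y in distr \<mu> ?B (\<tau> m n f). norm (h y) \<le> 1" using h(2) by (intro AE_I2) simp
      have "norm (D f) \<le> 1 * 1"
        using ae unfolding D_def
        by (intro order_trans[OF integral_norm_bound] order_trans[OF integral_le_const[where c = 1]])
           (use h(1) in \<open>auto intro!: integrable_norm integrable_const_bound[where B = 1]\<close>)
      then show ?thesis by simp
    qed
    have P: "(\<integral>x. h x \<partial>?P) = D (incl m)" by (simp add: D_def law_incl_def)
    have inj: "D f = D (incl m)" if "f \<in> fin_maps m n" "inj_on f {1..m}" for f
      using distr_injective[OF \<mu> mn that] by (simp add: D_def law_incl_def)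
    have Q: "(\<integral>x. h x \<partial>?Q) = (\<Sum>f\<in>fin_maps m n. D f) / real n ^ m"
      using integral_distr_pair_uniform_count[where g = "\<tau> m n", OF prob_space_borel_probs[OF \<mu>']
          fin_maps_finite fin_maps_nonempty[OF n] meas h]
      unfolding law_random_map_def D_def card_fin_maps of_nat_power .
    have "(\<Sum>f\<in>fin_maps m n. D (incl m) - D f) = real n ^ m * D (incl m) - (\<Sum>f\<in>fin_maps m n. D f)"
      by (simp only: sum_subtractf sum_constant card_fin_maps of_nat_power)
    then have "(\<integral>x. h x \<partial>?P) - (\<integral>x. h x \<partial>?Q) = (\<Sum>f\<in>fin_maps m n. D (incl m) - D f) / real n ^ m"
      using n unfolding P Q by (simp only: diff_divide_distrib) simp
    also have "(\<Sum>f\<in>fin_maps m n. D (incl m) - D f) = (\<Sum>f\<in>?N. D (incl m) - D f)"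
      by (rule sum.mono_neutral_right) (use inj fin_maps_finite in auto)
    finally have eq: "(\<integral>x. h x \<partial>?P) - (\<integral>x. h x \<partial>?Q) = (\<Sum>f\<in>?N. D (incl m) - D f) / real n ^ m" .
    have "\<bar>\<Sum>f\<in>?N. D (incl m) - D f\<bar> \<le> (\<Sum>f\<in>?N. 2)"
    proof (rule order_trans[OF sum_abs sum_mono])
      fix f assume "f \<in> ?N"
      then have "f \<in> fin_maps m n" by (rule CollectE) (erule conjunct1)
      from D_le[OF this] D_le[OF incl_in_fin_maps[OF mn(2)]]
      show "\<bar>D (incl m) - D f\<bar> \<le> 2" by linarith
    qed
    also have "\<dots> = 2 * real (card ?N)" by (simp only: sum_constant mult.commute)
    finally have "\<bar>\<Sum>f\<in>?N. D (incl m) - D f\<bar> / real n ^ m \<le> 2 * real (card ?N) / real n ^ m"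
      by (rule divide_right_mono) simp
    also have "\<dots> = 2 * (real (card ?N) / real n ^ m)" by (simp only: times_divide_eq_right)
    \<comment> \<open>The 2 from the range of the test functions cancels the denominator 2 of the
      birthday bound.\<close>
    also have "\<dots> \<le> 2 * (real m * (real m - 1) / (2 * real n))"
      by (rule mult_left_mono[OF card_non_injective_le[OF mn(2) n]]) simp
    also have "\<dots> = real m * (real m - 1) / real n" by simp
    finally show ?thesis unfolding eq by (simp only: abs_divide power_abs abs_of_nat)
  qed
  \<comment> \<open>The zero function makes the set of test functions nonempty and bounds the
    supremum below by 0; \<open>bound\<close> gives the boundedness above that a real supremum
    requires.\<close>
  have zero: "(\<lambda>_. 0) \<in> ?H" by simp
  have "bdd_above ((\<lambda>h. \<bar>(\<integral>x. h x \<partial>?P) - (\<integral>x. h x \<partial>?Q)\<bar>) ` ?H)"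
    by (rule bdd_aboveI2, rule bound)
  from cSUP_upper[OF zero this] show "0 \<le> tv_dist ?P ?Q" by (simp add: tv_dist_def)
  show "tv_dist ?P ?Q \<le> real m * (real m - 1) / real n"
    unfolding tv_dist_def
  proof (rule cSUP_least)
    show "?H \<noteq> {}" using zero by blast
  qed (rule bound)
qed

lemma limit_map_dense:
  assumes \<mu>: "\<mu> \<in> inv_limit \<tau> \<Omega>"
  shows "\<exists>\<nu>. (\<forall>i. \<nu> i \<in> limit_map \<tau> \<Omega> ` dir_limit \<tau> \<Omega>)
    \<and> (\<forall>m\<ge>1. (\<lambda>i. tv_dist (\<mu> m) (\<nu> i m)) \<longlonglongrightarrow> 0)"
proof (intro exI conjI allI impI)
  \<comment> \<open>The approximants are the images of the classes of the members of the sequence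
    itself; \<open>Suc i\<close> keeps the index positive.\<close>
  let ?\<nu> = "\<lambda>i. law_seq \<tau> \<Omega> (Suc i, \<mu> (Suc i))"
  have inv: "\<mu> n \<in> inv_probs \<tau> \<Omega> n" if "n \<ge> 1" for n
    using \<mu> that by (auto simp: inv_limit_def)
  have union: "(Suc i, \<mu> (Suc i)) \<in> dir_union \<tau> \<Omega>" for i
    using inv by (simp add: dir_union_def)
  show "?\<nu> i \<in> limit_map \<tau> \<Omega> ` dir_limit \<tau> \<Omega>" for i
    unfolding limit_map_class[OF union, symmetric] dir_limit_def
    by (rule imageI, rule quotientI[OF union])
  fix m :: nat assume m: "m \<ge> 1"
  \<comment> \<open>Consistency presents \<open>\<mu> m\<close> as a law along an inclusion for
    every larger \<open>n\<close>, so the bound compares it with the \<open>m\<close>-th term of the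
    approximant.\<close>
  have \<mu>m: "\<mu> m = law_incl \<tau> \<Omega> m n (\<mu> n)" if "m \<le> n" for n
    using \<mu> m that by (simp add: inv_limit_def)
  have bounds: "0 \<le> tv_dist (\<mu> m) (?\<nu> i m)"
      "tv_dist (\<mu> m) (?\<nu> i m) \<le> real m * (real m - 1) / real (Suc i)" if "m \<le> i" for i
    using tv_dist_law_bounds[OF inv[of "Suc i"] m] \<mu>m[of "Suc i"] m that by (simp_all add: law_seq_def)
  have lim: "(\<lambda>i. real m * (real m - 1) / real (Suc i)) \<longlonglongrightarrow> 0"
    using tendsto_mult[OF tendsto_const LIMSEQ_inverse_real_of_nat, of "real m * (real m - 1)"]
    by (simp add: divide_inverse)
  show "(\<lambda>i. tv_dist (\<mu> m) (?\<nu> i m)) \<longlonglongrightarrow> 0"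
    \<comment> \<open>The bounds are available from \<open>i = m\<close> onwards, hence
      eventually.\<close>
    by (rule tendsto_sandwich[OF _ _ tendsto_const lim];
        rule eventually_mono[OF eventually_ge_at_top[of m]], erule bounds)
qed

end

text \<open>The second conjunct pins down the value of \<open>limit_map\<close> on the class of
  every representative, so that the map built with \<open>the_elem\<close> is the intended
  one.\<close>

theorem theorem4p15:
  fixes V :: "nat \<Rightarrow> 'v::real_normed_vector set"
    and \<tau> :: "nat \<Rightarrow> nat \<Rightarrow> (nat \<Rightarrow> nat) \<Rightarrow> 'v \<Rightarrow> 'v"
    and ip :: "nat \<Rightarrow> 'v \<Rightarrow> 'v \<Rightarrow> real"
    and \<Omega> :: "nat \<Rightarrow> 'v set"
  assumes rep: "finset_op_rep V \<tau> ip"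
    and \<Omega>_subset: "\<And>n. n \<ge> 1 \<Longrightarrow> \<Omega> n \<subseteq> V n"
    and \<Omega>_closed: "\<And>m n f. m \<ge> 1 \<Longrightarrow> n \<ge> 1 \<Longrightarrow> f \<in> fin_maps m n \<Longrightarrow> \<tau> m n f ` \<Omega> n \<subseteq> \<Omega> m"
  shows "limit_map \<tau> \<Omega> \<in> dir_limit \<tau> \<Omega> \<rightarrow> inv_limit \<tau> \<Omega>
    \<and> (\<forall>n\<ge>1. \<forall>\<mu>\<in>inv_probs \<tau> \<Omega> n.
          limit_map \<tau> \<Omega> (dir_rel \<tau> \<Omega> `` {(n, \<mu>)}) = (\<lambda>m\<in>{1..}. law_random_map \<tau> \<Omega> m n \<mu>))
    \<and> (\<forall>\<mu>\<in>inv_limit \<tau> \<Omega>. \<exists>\<nu> :: nat \<Rightarrow> nat \<Rightarrow> 'v measure.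
          (\<forall>i. \<nu> i \<in> limit_map \<tau> \<Omega> ` dir_limit \<tau> \<Omega>)
          \<and> (\<forall>m\<ge>1. (\<lambda>i. tv_dist (\<mu> m) (\<nu> i m)) \<longlonglongrightarrow> 0))
    \<and> (\<forall>m n. \<forall>\<mu>\<in>inv_probs \<tau> V n. 1 \<le> m \<longrightarrow> m \<le> n \<longrightarrow>
          tv_dist (law_incl \<tau> V m n \<mu>) (law_random_map \<tau> V m n \<mu>)
            \<le> real m * (real m - 1) / real n)"
proof (intro conjI allI ballI impI)
  interpret finset_op_rep V \<tau> ip by (rule rep)
  interpret \<Omega>: finset_op_spaces V \<tau> ip \<Omega>
    by (intro finset_op_spaces.intro finset_op_spaces_axioms.intro rep \<Omega>_subset \<Omega>_closed)
  \<comment> \<open>The full spaces are themselves stable under the structure maps, which yields the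
    last conjunct on \<open>V\<close>.\<close>
  interpret V: finset_op_spaces V \<tau> ip V
    by (intro finset_op_spaces.intro finset_op_spaces_axioms.intro rep order_refl image_subsetI \<tau>_maps)
  show "limit_map \<tau> \<Omega> \<in> dir_limit \<tau> \<Omega> \<rightarrow> inv_limit \<tau> \<Omega>"
    by (rule \<Omega>.limit_map_in_inv_limit)
  show "limit_map \<tau> \<Omega> (dir_rel \<tau> \<Omega> `` {(n, \<mu>)}) = (\<lambda>m\<in>{1..}. law_random_map \<tau> \<Omega> m n \<mu>)"
    if "n \<ge> 1" "\<mu> \<in> inv_probs \<tau> \<Omega> n" for n \<mu>
    using \<Omega>.limit_map_class[of "(n, \<mu>)"] that by (simp add: dir_union_def law_seq_def)
  show "\<exists>\<nu> :: nat \<Rightarrow> nat \<Rightarrow> 'v measure. (\<forall>i. \<nu> i \<in> limit_map \<tau> \<Omega> ` dir_limit \<tau> \<Omega>)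
      \<and> (\<forall>m\<ge>1. (\<lambda>i. tv_dist (\<mu> m) (\<nu> i m)) \<longlonglongrightarrow> 0)" if "\<mu> \<in> inv_limit \<tau> \<Omega>" for \<mu>
    by (rule \<Omega>.limit_map_dense[OF that])
  show "tv_dist (law_incl \<tau> V m n \<mu>) (law_random_map \<tau> V m n \<mu>) \<le> real m * (real m - 1) / real n"
    if "\<mu> \<in> inv_probs \<tau> V n" "1 \<le> m" "m \<le> n" for m n \<mu>
    by (rule V.tv_dist_law_bounds(2)[OF that])
qed

end
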